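(* Let $a,b,z,x_1,\dots,x_n$ be complex parameters with $|z/a^{n-1}|<1$. Suppose that none of the denominators in the following identity vanishes. Then $$\begin{aligned} & \sum_{j_1,\dots,j_n\ge0}\ \prod_{1\leq r<s\leq n}\frac{1-q^{j_{r}-j_{s}}x_{r}/x_{s}}{1-x_{r}/x_{s}}\prod_{r,s=1}^{n}\frac{(ax_{r}/x_{s})_{j_{r}}}{(qx_{r}/x_{s})_{j_{r}}}\cdot\frac{(q)_{|\boldsymbol{j}|}}{\prod_{i=1}^{n}(bx_{i})_{j_{i}}}\Big(\frac{z}{a^{n-1}}\Big)^{|\boldsymbol{j}|}q^{\sum_{r=1}^{n}(r-1)j_{r}}\\ &=\sum_{k_1,\dots,k_n\ge0}\ \prod_{1\leq r<s\leq n}\frac{1-q^{k_{r}-k_{s}}x_{r}/x_{s}}{1-x_{r}/x_{s}}\prod_{r,s=1}^{n}\frac{(ax_{r}/x_{s})_{k_{r}}}{(qx_{r}/x_{s})_{k_{r}}}\\ &\quad\times\frac{(1-azq^{2|\boldsymbol{k}|})(q)_{|\boldsymbol{k}|}}{(z/a^{n-1})_{|\boldsymbol{k}|+1}}\prod_{i=1}^{n}\frac{(azq^{1+|\boldsymbol{k}|-k_{i}}/(bx_{i}))_{k_{i}}}{(bx_{i})_{k_{i}}}\\ &\quad\times\Big(\frac{bz}{a^{n-1}}\Big)^{|\boldsymbol{k}|}q^{\sum_{r=1}^{n}(r-1)k_{r}+\binom{|\boldsymbol{k}|}{2}+\sum_{i=1}^{n}\binom{k_{i}}{2}}\prod_{i=1}^{n}x_{i}^{k_{i}}.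 \end{aligned}$$
   Context: $q$ is a complex number with $0<|q|<1$ and $n\ge1$ is an integer. $(z)_k=\prod_{i=0}^{k-1}(1-zq^i)$ for integers $k\ge0$. Bold letters denote multi-indices of nonnegative integers, $\boldsymbol k=(k_1,\dots,k_n)$, with $|\boldsymbol k|=k_1+\cdots+k_n$. *)

theory Defs
  imports "HOL-Analysis.Analysis" "HOL-Library.FuncSet"
begin

definition qpoch :: "complex \<Rightarrow> complex \<Rightarrow> nat \<Rightarrow> complex" where
  "qpoch q z k = (\<Prod>i<k. 1 - z * q ^ i)"

text \<open>
  A multi-index \<open>(k\<^sub>1, \<dots>, k\<^sub>n)\<close> is an extensional function on \<open>{1..n}\<close>, so that each
  multi-index is represented by exactly one function.
\<close>

definition multi_indices :: "nat \<Rightarrow> (nat \<Rightarrow> nat) set" where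
  "multi_indices n = {1..n} \<rightarrow>\<^sub>E (UNIV :: nat set)"

definition mweight :: "nat \<Rightarrow> (nat \<Rightarrow> nat) \<Rightarrow> nat" where
  "mweight n k = (\<Sum>i=1..n. k i)"

text \<open>
  In both terms below, \<open>q\<^bsup>k\<^sub>r - k\<^sub>s\<^esup>\<close> is an integer power, as the exponent may be negative;
  the exponents \<open>r - 1\<close> and \<open>1 + \<bar>k\<bar> - k\<^sub>i\<close> are never negative, so natural
  subtraction does not truncate.
\<close>

definition lhs_term ::
  "nat \<Rightarrow> complex \<Rightarrow> complex \<Rightarrow> complex \<Rightarrow> complex \<Rightarrow> (nat \<Rightarrow> complex) \<Rightarrow> (nat \<Rightarrow> nat) \<Rightarrow> complex"
where
  "lhs_term n q a b z x j =
     (\<Prod>r=1..n. \<Prod>s\<in>{r<..n}.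
        (1 - q powi (int (j r) - int (j s)) * (x r / x s)) / (1 - x r / x s)) *
     (\<Prod>r=1..n. \<Prod>s=1..n. qpoch q (a * x r / x s) (j r) / qpoch q (q * x r / x s) (j r)) *
     (qpoch q q (mweight n j) / (\<Prod>i=1..n. qpoch q (b * x i) (j i))) *
     (z / a ^ (n - 1)) ^ mweight n j *
     q ^ (\<Sum>r=1..n. (r - 1) * j r)"

definition rhs_term ::
  "nat \<Rightarrow> complex \<Rightarrow> complex \<Rightarrow> complex \<Rightarrow> complex \<Rightarrow> (nat \<Rightarrow> complex) \<Rightarrow> (nat \<Rightarrow> nat) \<Rightarrow> complex"
where
  "rhs_term n q a b z x k =
     (\<Prod>r=1..n. \<Prod>s\<in>{r<..n}.
        (1 - q powi (int (k r) - int (k s)) * (x r / x s)) / (1 - x r / x s)) *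
     (\<Prod>r=1..n. \<Prod>s=1..n. qpoch q (a * x r / x s) (k r) / qpoch q (q * x r / x s) (k r)) *
     ((1 - a * z * q ^ (2 * mweight n k)) * qpoch q q (mweight n k) /
        qpoch q (z / a ^ (n - 1)) (mweight n k + 1)) *
     (\<Prod>i=1..n. qpoch q (a * z * q ^ (1 + mweight n k - k i) / (b * x i)) (k i) /
        qpoch q (b * x i) (k i)) *
     (b * z / a ^ (n - 1)) ^ mweight n k *
     q ^ ((\<Sum>r=1..n. (r - 1) * k r) + (mweight n k choose 2) + (\<Sum>i=1..n. k i choose 2)) *
     (\<Prod>i=1..n. x i ^ k i)"

end

theory Submission
  imports Defs
begin

text \<open>
  Write \<open>w = z / a\<^sup>n\<^sup>-\<^sup>1\<close>, \<open>X\<^sub>i = b x\<^sub>i\<close>, and let \<open>W(k)\<close> be the weight common to both sides (it is invariant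
  under scaling all \<open>x\<^sub>i\<close>). Both series are graded by \<open>N = |k|\<close>, and their degree \<open>N\<close> parts are
  specialisations of the same finite sum
  \<open>S\<^sub>N(X, D, E) = \<Sum>|k|=N. W(k) \<Prod>i. \<Prod>t<k\<^sub>i. (D - E X\<^sub>i q\<^sup>t) / (1 - X\<^sub>i q\<^sup>t)\<close>,
  namely \<open>D = 1, E = 0\<close> on the left and \<open>D = a z q\<^sup>N, E = 1\<close> on the right. Two Lagrange
  interpolations, one at the points \<open>X\<^sub>i q^k\<^sub>i\<close> before and one after lowering a \<open>k\<^sub>i\<close>, give a
  recursion expressing \<open>(1 - q\<^sup>N) S\<^sub>N(X, D, E)\<close> by \<open>S\<^sub>N\<^sub>-\<^sub>1(X, D, E)\<close> and \<open>S\<^sub>N\<^sub>-\<^sub>1(q X, q D, E)\<close>. Hence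
  \<open>S\<^sub>N\<close> is a single sum over \<open>d \<le> N\<close> of coefficients independent of \<open>X\<close> times
  \<open>Q\<^sub>d(X) = \<Prod>s. \<Prod>t<d. (a - X\<^sub>s q\<^sup>t) / (1 - X\<^sub>s q\<^sup>t)\<close>. Interchanging the summations, the inner sums
  over \<open>N - d\<close> can be evaluated: on the left by the \<open>q\<close>-binomial series, on the right by a
  telescoping sum with value \<open>1\<close>. Both sides become
  \<open>\<Sum>d. (-w)\<^sup>d q^(d choose 2) Q\<^sub>d(X) / (w)\<^sub>d\<^sub>+\<^sub>1\<close>.
\<close>

section \<open>Partial fraction identities from divided differences\<close>

section \<open>Lagrange interpolation\<close>

text \<open>\<open>p\<close> equals its Lagrange interpolant on \<open>S\<close>, since its degree
  is below the number of nodes. Each basis polynomial is a scaled monic polynomial of degree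
  \<open>card S - 1\<close>, so comparing coefficients in that degree gives the divided
  difference.\<close>

lemma sum_divided_difference:
  fixes p :: "complex poly"
  assumes fin: "finite S" and deg: "degree p < card S"
  shows "(\<Sum>u\<in>S. poly p u / (\<Prod>v\<in>S-{u}. u - v)) = coeff p (card S - 1)"
proof -
  define L where "L u = smult (poly p u / (\<Prod>v\<in>S-{u}. u - v)) (\<Prod>v\<in>S-{u}. [:-v, 1:])" for u
  have deg0: "degree (\<Prod>v\<in>S-{u}. [:-v, 1:]) = card S - 1" if "u \<in> S" for u
    using that fin by (subst degree_prod_eq_sum_degree) auto
  have lead: "coeff (\<Prod>v\<in>S-{u}. [:-v, 1:]) (card S - 1) = 1" if "u \<in> S" for u
    using lead_coeff_prod[of "\<lambda>v. [:-v, 1:]" "S-{u}"] deg0[OF that] by simp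
  have card: "card S > 0" using deg by simp
  have "p = (\<Sum>u\<in>S. L u)"
  proof (rule poly_eqI_degree[of S])
    fix w assume w: "w \<in> S"
    have "poly (L u) w = (if u = w then poly p w else 0)" if "u \<in> S" for u
    proof (cases "u = w")
      case True
      have "(\<Prod>v\<in>S-{w}. w - v) \<noteq> 0" using fin by auto
      then show ?thesis using True by (simp add: L_def poly_prod)
    next
      case False
      then have "(\<Prod>v\<in>S-{u}. w - v) = 0" using fin w by auto
      then show ?thesis using False by (simp add: L_def poly_prod)
    qed
    then show "poly p w = poly (\<Sum>u\<in>S. L u) w"
      using w fin by (simp add: poly_sum)
  next
    show "card S > degree p" by fact
    have "degree (L u) \<le> card S - 1" if "u \<in> S" for u
      unfolding L_def using deg0[OF that] degree_smult_le by metis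
    then have "degree (\<Sum>u\<in>S. L u) \<le> card S - 1"
      using fin by (intro degree_sum_le) auto
    then show "card S > degree (\<Sum>u\<in>S. L u)" using card by linarith
  qed
  then have "coeff p (card S - 1) = (\<Sum>u\<in>S. coeff (L u) (card S - 1))"
    by (metis coeff_sum)
  also have "\<dots> = (\<Sum>u\<in>S. poly p u / (\<Prod>v\<in>S-{u}. u - v))"
    using lead by (intro sum.cong) (simp_all add: L_def)
  finally show ?thesis by simp
qed

text \<open>The coefficient is read off at position \<open>card I\<close> rather than at the degree,
  because the degree drops as soon as some \<open>d s\<close> is 0.\<close>

lemma degree_prod_linear_le:
  fixes c d :: "'b \<Rightarrow> complex"
  assumes "finite I"
  shows "degree (\<Prod>s\<in>I. [:c s, d s:]) \<le> card I"
    and "coeff (\<Prod>s\<in>I. [:c s, d s:]) (card I) = (\<Prod>s\<in>I. d s)"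
proof -
  have "degree (\<Prod>s\<in>I. [:c s, d s:]) \<le> card I \<and>
        coeff (\<Prod>s\<in>I. [:c s, d s:]) (card I) = (\<Prod>s\<in>I. d s)"
    using assms
  proof (induction I)
    case (insert i I)
    let ?p = "\<Prod>s\<in>I. [:c s, d s:]"
    have "degree ([:c i, d i:] * ?p) \<le> degree [:c i, d i:] + degree ?p"
      by (rule degree_mult_le)
    also have "\<dots> \<le> 1 + card I"
      using insert.IH by (intro add_mono) auto
    finally have 1: "degree ([:c i, d i:] * ?p) \<le> Suc (card I)" by simp
    have "coeff ?p (Suc (card I)) = 0"
      using insert.IH by (intro coeff_eq_0) auto
    then have "coeff ([:c i, d i:] * ?p) (Suc (card I)) = d i * coeff ?p (card I)"
      by simp
    with 1 insert show ?case by simp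
  qed simp
  then show "degree (\<Prod>s\<in>I. [:c s, d s:]) \<le> card I"
    and "coeff (\<Prod>s\<in>I. [:c s, d s:]) (card I) = (\<Prod>s\<in>I. d s)" by auto
qed

lemma prod_minus_swap:
  fixes f g :: "'b \<Rightarrow> complex"
  shows "(\<Prod>v\<in>A. f v - g v) = (-1) ^ card A * (\<Prod>v\<in>A. g v - f v)"
proof -
  have "(\<Prod>v\<in>A. f v - g v) = (\<Prod>v\<in>A. (-1) * (g v - f v))" by simp
  also have "\<dots> = (-1) ^ card A * (\<Prod>v\<in>A. g v - f v)"
    by (subst prod.distrib) simp
  finally show ?thesis .
qed

text \<open>Divided difference of the polynomial \<open>prod (x s - u)\<close> in \<open>u\<close>
  at the nodes \<open>y i\<close> and the extra node \<open>0\<close>. The node \<open>0\<close>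
  contributes the quotient of products, the top coefficient the \<open>1\<close>. With
  \<open>y i = x i * q ^ k i\<close> the right side becomes \<open>1 / q ^ N - 1\<close>, which is
  how the degree \<open>N\<close> enters the recursion.\<close>

lemma partial_fraction_shift:
  fixes x y :: "'b \<Rightarrow> complex"
  assumes fin: "finite I" and y0: "\<And>i. i \<in> I \<Longrightarrow> y i \<noteq> 0" and inj: "inj_on y I"
  shows "(\<Sum>i\<in>I. (\<Prod>s\<in>I. x s - y i) / (y i * (\<Prod>s\<in>I-{i}. y s - y i)))
    = (\<Prod>s\<in>I. x s) / (\<Prod>s\<in>I. y s) - 1"
proof -
  define p where "p = (\<Prod>s\<in>I. [:x s, -1:])"
  define S where "S = insert 0 (y ` I)"
  have 0: "0 \<notin> y ` I" using y0 by auto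
  have cS: "card S = Suc (card I)"
    using fin 0 inj by (simp add: S_def card_image)
  have pv: "poly p u = (\<Prod>s\<in>I. x s - u)" for u by (simp add: p_def poly_prod)
  have S0: "S - {0} = y ` I" using 0 by (auto simp: S_def)
  have Si: "S - {y i} = insert 0 (y ` (I - {i}))" if "i \<in> I" for i
    using that y0 inj by (auto simp: S_def inj_on_def)
  have prod0: "(\<Prod>v\<in>S-{0}. 0 - v) = (-1) ^ card I * (\<Prod>s\<in>I. y s)"
  proof -
    have "(\<Prod>v\<in>S-{0}. 0 - v) = (\<Prod>s\<in>I. 0 - y s)"
      using inj unfolding S0 by (subst prod.reindex) simp_all
    then show ?thesis unfolding prod_minus_swap[of "\<lambda>_. 0"] by simp
  qed
  have prodi: "(\<Prod>v\<in>S-{y i}. y i - v) = - ((-1) ^ card I * (y i * (\<Prod>s\<in>I-{i}. y s - y i)))"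
    if i: "i \<in> I" for i
  proof -
    have "0 \<notin> y ` (I - {i})" "inj_on y (I - {i})"
      using y0 inj by (auto simp: inj_on_def)
    then have "(\<Prod>v\<in>S-{y i}. y i - v) = y i * (\<Prod>s\<in>I-{i}. y i - y s)"
      using fin unfolding Si[OF i] by (simp add: prod.reindex)
    moreover have "(-1::complex) ^ card I = - ((-1) ^ card (I - {i}))"
      using card.remove[OF fin i] by simp
    ultimately show ?thesis
      unfolding prod_minus_swap[of "\<lambda>_. y i"] by simp
  qed
  have "(\<Sum>u\<in>S. poly p u / (\<Prod>v\<in>S-{u}. u - v)) = coeff p (card S - 1)"
    using degree_prod_linear_le(1)[OF fin, of x "\<lambda>_. -1"] fin cS
    by (intro sum_divided_difference) (auto simp: S_def p_def)
  also have "coeff p (card S - 1) = (-1) ^ card I"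
    using degree_prod_linear_le(2)[OF fin, of x "\<lambda>_. -1"] cS by (simp add: p_def)
  also have "(\<Sum>u\<in>S. poly p u / (\<Prod>v\<in>S-{u}. u - v)) =
     poly p 0 / (\<Prod>v\<in>S-{0}. 0 - v) + (\<Sum>i\<in>I. poly p (y i) / (\<Prod>v\<in>S-{y i}. y i - v))"
    using fin 0 inj unfolding S_def by (subst sum.insert) (simp_all add: sum.reindex)
  also have "(\<Sum>i\<in>I. poly p (y i) / (\<Prod>v\<in>S-{y i}. y i - v))
    = - ((-1) ^ card I * (\<Sum>i\<in>I. (\<Prod>s\<in>I. x s - y i) / (y i * (\<Prod>s\<in>I-{i}. y s - y i))))"
    unfolding sum_distrib_left sum_negf[symmetric]
    by (rule sum.cong) (simp_all add: prodi pv power_one_over[symmetric] divide_simps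
        flip: power_mult_distrib)
  also have "poly p 0 / (\<Prod>v\<in>S-{0}. 0 - v) = (-1) ^ card I * ((\<Prod>s\<in>I. x s) / (\<Prod>s\<in>I. y s))"
    unfolding prod0 pv by (simp add: divide_simps flip: power_mult_distrib)
  finally have "(-1) ^ card I * ((\<Prod>s\<in>I. x s) / (\<Prod>s\<in>I. y s) -
      (\<Sum>i\<in>I. (\<Prod>s\<in>I. x s - y i) / (y i * (\<Prod>s\<in>I-{i}. y s - y i))) - 1) = 0"
    by (simp add: algebra_simps)
  then have "(\<Prod>s\<in>I. x s) / (\<Prod>s\<in>I. y s) -
      (\<Sum>i\<in>I. (\<Prod>s\<in>I. x s - y i) / (y i * (\<Prod>s\<in>I-{i}. y s - y i))) = 1" by simp
  then show ?thesis by (simp add: algebra_simps)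
qed

text \<open>Here the nodes are \<open>0\<close>, \<open>1\<close> and the \<open>w i\<close>, and
  the polynomial \<open>(D - E u) prod (x s - a s u)\<close> has degree at most
  \<open>card I + 1\<close>. The three terms on the right come from the node \<open>0\<close>, the
  top coefficient and the node \<open>1\<close>, in this order. The last one will produce the sum at
  \<open>q * x\<close>.\<close>

lemma partial_fraction_unshift:
  fixes x w a :: "'b \<Rightarrow> complex"
  assumes fin: "finite I" and w0: "\<And>i. i \<in> I \<Longrightarrow> w i \<noteq> 0" and w1: "\<And>i. i \<in> I \<Longrightarrow> w i \<noteq> 1"
    and inj: "inj_on w I"
  shows "(\<Sum>i\<in>I. (\<Prod>s\<in>I. x s - a s * w i) * (D - E * w i) /
                 (w i * (1 - w i) * (\<Prod>s\<in>I-{i}. w s - w i)))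
    = D * (\<Prod>s\<in>I. x s) / (\<Prod>s\<in>I. w s) - E * (\<Prod>s\<in>I. a s)
      + (E - D) * (\<Prod>s\<in>I. a s - x s) / (\<Prod>s\<in>I. 1 - w s)"
proof -
  define g where "g = (\<Prod>s\<in>I. [:x s, - a s:])"
  define p where "p = [:D, -E:] * g"
  define S where "S = insert 0 (insert 1 (w ` I))"
  define T where "T = (\<Sum>i\<in>I. (\<Prod>s\<in>I. x s - a s * w i) * (D - E * w i) /
                 (w i * (1 - w i) * (\<Prod>s\<in>I-{i}. w s - w i)))"
  have 0: "0 \<notin> insert 1 (w ` I)" and 1: "1 \<notin> w ` I" using w0 w1 by (auto simp: image_iff)
  have cS: "card S = Suc (Suc (card I))"
    using fin 0 1 inj by (simp add: S_def card_image)
  have pv: "poly p u = (\<Prod>s\<in>I. x s - a s * u) * (D - E * u)" for u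
    by (simp add: p_def g_def poly_prod algebra_simps)
  have S0: "S - {0} = insert 1 (w ` I)" using 0 by (auto simp: S_def)
  have S1: "S - {1} = insert 0 (w ` I)" using 1 by (auto simp: S_def)
  have Si: "S - {w i} = insert 0 (insert 1 (w ` (I - {i})))" if "i \<in> I" for i
    using that w0 w1 inj by (auto simp: S_def inj_on_def)
  have prod0: "(\<Prod>v\<in>S-{0}. 0 - v) = - ((-1) ^ card I * (\<Prod>s\<in>I. w s))"
  proof -
    have "(\<Prod>v\<in>S-{0}. 0 - v) = - (\<Prod>s\<in>I. 0 - w s)"
      using inj fin 1 unfolding S0 by (subst prod.insert) (simp_all add: prod.reindex)
    then show ?thesis unfolding prod_minus_swap[of "\<lambda>_. 0"] by simp
  qed
  have prod1: "(\<Prod>v\<in>S-{1}. 1 - v) = (\<Prod>s\<in>I. 1 - w s)"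
    using inj fin 0 unfolding S1 by (subst prod.insert) (simp_all add: prod.reindex)
  have prodi: "(\<Prod>v\<in>S-{w i}. w i - v) = (-1) ^ card I * (w i * (1 - w i) * (\<Prod>s\<in>I-{i}. w s - w i))"
    if i: "i \<in> I" for i
  proof -
    have "0 \<notin> w ` (I - {i})" "1 \<notin> w ` (I - {i})" "inj_on w (I - {i})"
      using w0 w1 inj by (auto simp: inj_on_def image_iff)
    then have "(\<Prod>v\<in>S-{w i}. w i - v) = w i * ((w i - 1) * (\<Prod>s\<in>I-{i}. w i - w s))"
      using fin unfolding Si[OF i] by (simp add: prod.reindex)
    moreover have "(-1::complex) ^ card I = - ((-1) ^ card (I - {i}))"
      using card.remove[OF fin i] by simp
    ultimately show ?thesis
      unfolding prod_minus_swap[of "\<lambda>_. w i"] by (simp add: algebra_simps)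
  qed
  have dg: "degree g \<le> card I" "coeff g (card I) = (\<Prod>s\<in>I. - a s)"
    using degree_prod_linear_le[OF fin, of x "\<lambda>s. - a s"] by (simp_all add: g_def)
  have "degree p \<le> degree [:D, -E:] + degree g"
    unfolding p_def by (rule degree_mult_le)
  also have "\<dots> \<le> 1 + card I" using dg by (intro add_mono) auto
  finally have dp: "degree p < card S" using cS by simp
  have "coeff g (Suc (card I)) = 0" using dg by (intro coeff_eq_0) auto
  then have cp: "coeff p (card S - 1) = - E * (\<Prod>s\<in>I. - a s)"
    by (simp add: p_def cS dg)
  have m: "(\<Prod>s\<in>I. - a s) = (-1) ^ card I * (\<Prod>s\<in>I. a s)"
    using prod_minus_swap[of "\<lambda>_. 0" a I] by simp
  have p1: "poly p 1 = (-1) ^ card I * ((D - E) * (\<Prod>s\<in>I. a s - x s))"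
    unfolding pv using prod_minus_swap[of x a I] by simp
  have sq: "(-1::complex) ^ card I * (-1) ^ card I = 1"
    by (simp flip: power_mult_distrib)
  have "(\<Sum>u\<in>S. poly p u / (\<Prod>v\<in>S-{u}. u - v)) = coeff p (card S - 1)"
    using dp fin by (intro sum_divided_difference) (auto simp: S_def)
  also have "(\<Sum>u\<in>S. poly p u / (\<Prod>v\<in>S-{u}. u - v)) =
     poly p 0 / (\<Prod>v\<in>S-{0}. 0 - v) + (poly p 1 / (\<Prod>v\<in>S-{1}. 1 - v) +
       (\<Sum>i\<in>I. poly p (w i) / (\<Prod>v\<in>S-{w i}. w i - v)))"
    using fin 0 1 inj unfolding S_def by (simp add: sum.reindex)
  also have "(\<Sum>i\<in>I. poly p (w i) / (\<Prod>v\<in>S-{w i}. w i - v)) = (-1) ^ card I * T"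
    unfolding sum_distrib_left T_def
    by (rule sum.cong) (simp_all add: prodi pv divide_simps flip: power_mult_distrib)
  also have "poly p 0 / (\<Prod>v\<in>S-{0}. 0 - v) = - ((-1) ^ card I * (D * (\<Prod>s\<in>I. x s) / (\<Prod>s\<in>I. w s)))"
    unfolding prod0 pv by (simp add: divide_simps flip: power_mult_distrib)
  also have "poly p 1 / (\<Prod>v\<in>S-{1}. 1 - v) =
      (-1) ^ card I * ((D - E) * (\<Prod>s\<in>I. a s - x s) / (\<Prod>s\<in>I. 1 - w s))"
    unfolding prod1 p1 by simp
  finally have "(-1) ^ card I * (T - (D * (\<Prod>s\<in>I. x s) / (\<Prod>s\<in>I. w s) - E * (\<Prod>s\<in>I. a s)
      + (E - D) * (\<Prod>s\<in>I. a s - x s) / (\<Prod>s\<in>I. 1 - w s))) = 0"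
    unfolding cp m by (simp add: algebra_simps diff_divide_distrib)
  then show ?thesis unfolding T_def by simp
qed

section \<open>Weights on compositions: raising an index and scaling the variables\<close>

section \<open>The finite sums over compositions\<close>

text \<open>Injectivity keeps the Vandermonde denominators away from 0, the last clause the factors
  \<open>x s - x r * q ^ Suc t\<close>. Its exponent starts at 1 so that \<open>i = j\<close> can be
  included.\<close>

definition nonresonant :: "nat set \<Rightarrow> complex \<Rightarrow> (nat \<Rightarrow> complex) \<Rightarrow> bool" where
  "nonresonant I q x \<longleftrightarrow> (\<forall>i\<in>I. x i \<noteq> 0) \<and> inj_on x I \<and>
     (\<forall>i\<in>I. \<forall>j\<in>I. \<forall>m. x i * q ^ Suc m \<noteq> x j)"

definition pairs :: "nat set \<Rightarrow> (nat \<times> nat) set" where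
  "pairs I = {(r, s) \<in> I \<times> I. r < s}"

text \<open>
  The factor \<open>q^(\<Sum>r. (r - 1) k\<^sub>r)\<close> of the series is absorbed into the quotient of Vandermonde products,
  each factor of which is then symmetric in \<open>r\<close> and \<open>s\<close>.
\<close>

definition milne_weight ::
  "nat set \<Rightarrow> complex \<Rightarrow> (nat \<Rightarrow> complex) \<Rightarrow> (nat \<Rightarrow> complex) \<Rightarrow> (nat \<Rightarrow> nat) \<Rightarrow> complex"
where
  "milne_weight I q a x k =
     (\<Prod>(r, s)\<in>pairs I. (x s * q ^ k s - x r * q ^ k r) / (x s - x r)) *
     (\<Prod>r\<in>I. \<Prod>s\<in>I. \<Prod>t<k r. (x s - a s * x r * q ^ t) / (x s - x r * q ^ Suc t))"

definition milne_term ::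
  "nat set \<Rightarrow> complex \<Rightarrow> (nat \<Rightarrow> complex) \<Rightarrow> (nat \<Rightarrow> complex) \<Rightarrow> complex \<Rightarrow> complex \<Rightarrow> (nat \<Rightarrow> nat) \<Rightarrow> complex"
where
  "milne_term I q a x D E k =
     milne_weight I q a x k * (\<Prod>i\<in>I. \<Prod>t<k i. (D - E * x i * q ^ t) / (1 - x i * q ^ t))"

definition compositions :: "nat set \<Rightarrow> nat \<Rightarrow> (nat \<Rightarrow> nat) set" where
  "compositions I N = {k \<in> I \<rightarrow>\<^sub>E UNIV. (\<Sum>i\<in>I. k i) = N}"

lemma finite_compositions:
  assumes "finite I"
  shows "finite (compositions I N)"
proof (rule finite_subset)
  show "compositions I N \<subseteq> I \<rightarrow>\<^sub>E {..N}"
  proof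
    fix k assume k: "k \<in> compositions I N"
    then have "k i \<le> N" if "i \<in> I" for i
      using member_le_sum[of i I k] assms that by (simp add: compositions_def)
    then show "k \<in> I \<rightarrow>\<^sub>E {..N}" using k by (auto simp: compositions_def PiE_iff)
  qed
  show "finite (I \<rightarrow>\<^sub>E {..N})" using assms by (intro finite_PiE) auto
qed

lemma compositions_0: "finite I \<Longrightarrow> compositions I 0 = {restrict (\<lambda>_. 0) I}"
  by (auto simp: compositions_def PiE_def extensional_def restrict_def)

lemma compositions_Suc_positive:
  assumes fin: "finite I" and i: "i \<in> I"
  shows "bij_betw (\<lambda>k. k(i := Suc (k i))) (compositions I N) {k \<in> compositions I (Suc N). k i > 0}"
proof (rule bij_betwI[where g = "\<lambda>k. k(i := k i - 1)"])
  have upd: "(\<Sum>j\<in>I. (k(i := c)) j) = c + (\<Sum>j\<in>I-{i}. k j)" for k :: "nat \<Rightarrow> nat" and c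
    using fin i by (simp add: sum.remove)
  have rem: "(\<Sum>j\<in>I. k j) = k i + (\<Sum>j\<in>I-{i}. k j)" for k :: "nat \<Rightarrow> nat"
    using fin i by (simp add: sum.remove)
  have mem: "k(i := c) \<in> I \<rightarrow>\<^sub>E UNIV" if "k \<in> I \<rightarrow>\<^sub>E UNIV" for k :: "nat \<Rightarrow> nat" and c
    using i that by (auto simp: PiE_iff extensional_def)
  show "(\<lambda>k. k(i := Suc (k i))) \<in> compositions I N \<rightarrow> {k \<in> compositions I (Suc N). k i > 0}"
  proof
    fix k assume k: "k \<in> compositions I N"
    then have "(\<Sum>j\<in>I. (k(i := Suc (k i))) j) = Suc N"
      unfolding upd by (simp add: compositions_def rem[of k])
    then show "k(i := Suc (k i)) \<in> {k \<in> compositions I (Suc N). k i > 0}"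
      using k mem[of k] by (simp add: compositions_def del: PiE_iff)
  qed
  show "(\<lambda>k. k(i := k i - 1)) \<in> {k \<in> compositions I (Suc N). k i > 0} \<rightarrow> compositions I N"
  proof
    fix k assume k: "k \<in> {k \<in> compositions I (Suc N). k i > 0}"
    then have "(\<Sum>j\<in>I. (k(i := k i - 1)) j) = N"
      unfolding upd by (simp add: compositions_def rem[of k])
    then show "k(i := k i - 1) \<in> compositions I N"
      using k mem[of k] by (simp add: compositions_def del: PiE_iff)
  qed
qed auto

text \<open>Symmetry of \<open>h\<close> allows any index \<open>i\<close> to be split off, wherever
  it lies in the order: its pair with \<open>s\<close> is stored as
  \<open>(min i s, max i s)\<close>.\<close>

lemma prod_pairs_insert:
  fixes h :: "nat \<Rightarrow> nat \<Rightarrow> complex"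
  assumes fin: "finite F" and i: "i \<notin> F" and sym: "\<And>r s. h r s = h s r"
  shows "(\<Prod>(r, s)\<in>pairs (insert i F). h r s) = (\<Prod>s\<in>F. h i s) * (\<Prod>(r, s)\<in>pairs F. h r s)"
proof -
  let ?m = "\<lambda>s. (min i s, max i s)"
  have "pairs (insert i F) = ?m ` F \<union> pairs F"
    using i by (auto simp: pairs_def image_iff min_def max_def split: if_splits) (force | metis nat_less_le)+
  moreover have "?m ` F \<inter> pairs F = {}"
    using i by (auto simp: pairs_def min_def max_def split: if_splits)
  moreover have "finite (pairs F)"
    by (rule finite_subset[of _ "F \<times> F"]) (use fin in \<open>auto simp: pairs_def\<close>)
  ultimately have "(\<Prod>(r, s)\<in>pairs (insert i F). h r s) =
      (\<Prod>(r, s)\<in>?m ` F. h r s) * (\<Prod>(r, s)\<in>pairs F. h r s)"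
    using fin by (simp add: prod.union_disjoint)
  also have "inj_on ?m F" using i by (auto simp: inj_on_def min_def max_def split: if_splits)
  then have "(\<Prod>(r, s)\<in>?m ` F. h r s) = (\<Prod>s\<in>F. h (min i s) (max i s))"
    by (subst prod.reindex) (simp_all)
  also have "\<dots> = (\<Prod>s\<in>F. h i s)"
    using sym by (intro prod.cong) (auto simp: min_def max_def)
  finally show ?thesis .
qed

text \<open>Cancelling the smaller power of \<open>q\<close> reduces the claim to
  \<open>nonresonant\<close>. It makes the interpolation nodes \<open>x i * q ^ k i\<close> distinct
  for every multi-index.\<close>

lemma nonresonant_shifts_distinct:
  assumes nr: "nonresonant I q x" and q: "q \<noteq> 0" and ij: "i \<in> I" "j \<in> I" "i \<noteq> j"
  shows "x i * q ^ m \<noteq> x j * q ^ l"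
proof -
  have *: "x i * q ^ d \<noteq> x j" if "i \<in> I" "j \<in> I" "i \<noteq> j" for i j d
    using nr that by (cases d) (auto simp: nonresonant_def inj_on_def simp del: power_Suc)
  show ?thesis
  proof (cases "m \<le> l")
    case True
    then have "x j * q ^ l = (x j * q ^ (l - m)) * q ^ m"
      by (simp add: power_add[symmetric])
    then show ?thesis using *[of j i "l - m"] ij q by auto
  next
    case False
    then have "x i * q ^ m = (x i * q ^ (m - l)) * q ^ l"
      by (simp add: power_add[symmetric])
    then show ?thesis using *[of i j "m - l"] ij q by auto
  qed
qed

text \<open>Raising \<open>k i\<close> changes only the pair factors that contain \<open>i\<close>,
  row \<open>i\<close> of the double product and the factor \<open>i\<close> of the last product.
  The extra quotients are placed so that the left side has the shape of a summand of
  \<open>partial_fraction_shift\<close> at the raised index, and the right side that of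
  \<open>partial_fraction_unshift\<close> at the old one.\<close>

lemma milne_term_raise:
  fixes k :: "nat \<Rightarrow> nat"
  assumes fin: "finite I" and q: "q \<noteq> 0" and nr: "nonresonant I q x" and i: "i \<in> I"
    and x1: "\<And>t. x i * q ^ t \<noteq> 1"
  defines "k' \<equiv> k(i := Suc (k i))" and "w \<equiv> \<lambda>s. x s * q ^ k s"
  shows "milne_term I q a x D E k' * (\<Prod>s\<in>I. x s - q * w i) / (\<Prod>s\<in>I-{i}. w s - q * w i)
     = milne_term I q a x D E k * ((\<Prod>s\<in>I. x s - a s * w i) * (D - E * w i)) /
         ((1 - w i) * (\<Prod>s\<in>I-{i}. w s - w i))"
proof -
  define F where "F = I - {i}"
  have F: "finite F" "i \<notin> F" "I = insert i F" using fin i by (auto simp: F_def)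
  define h where "h k r s = (x s * q ^ k s - x r * q ^ k r) / (x s - x r)" for k :: "nat \<Rightarrow> nat" and r s
  have hsym: "h k r s = h k s r" for k r s
    unfolding h_def by (subst minus_divide_divide[symmetric]) simp
  have k'i: "k' i = Suc (k i)" and k'F: "\<And>s. s \<in> F \<Longrightarrow> k' s = k s"
    using F by (auto simp: k'_def)
  define P where "P = (\<Prod>(r, s)\<in>pairs F. h k r s)"
  have P': "(\<Prod>(r, s)\<in>pairs F. h k' r s) = P"
    unfolding P_def by (rule prod.cong) (auto simp: pairs_def h_def k'F)
  have wi': "x i * q ^ k' i = q * w i" by (simp add: k'i w_def)
  have dx: "(\<Prod>s\<in>F. x s - x i) \<noteq> 0"
    using nr F by (auto simp: nonresonant_def inj_on_def)
  have dw: "(\<Prod>s\<in>F. w s - w i) \<noteq> 0" "(\<Prod>s\<in>F. w s - q * w i) \<noteq> 0"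
  proof -
    have "w s \<noteq> w i" "w s \<noteq> q * w i" if "s \<in> F" for s
    proof -
      have s: "s \<in> I" "s \<noteq> i" using that by (auto simp: F_def)
      show "w s \<noteq> w i" "w s \<noteq> q * w i"
        using nonresonant_shifts_distinct[OF nr q s(1) i s(2), of "k s" "k i"]
           nonresonant_shifts_distinct[OF nr q s(1) i s(2), of "k s" "Suc (k i)"]
        by (simp_all add: w_def mult_ac)
    qed
    then show "(\<Prod>s\<in>F. w s - w i) \<noteq> 0" "(\<Prod>s\<in>F. w s - q * w i) \<noteq> 0"
      using F(1) by auto
  qed
  have "(\<Prod>s\<in>F. h k i s) = (\<Prod>s\<in>F. w s - w i) / (\<Prod>s\<in>F. x s - x i)"
    unfolding prod_dividef[symmetric]
    by (rule prod.cong) (simp_all add: h_def w_def)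
  then have A: "(\<Prod>(r, s)\<in>pairs I. h k r s) = (\<Prod>s\<in>F. w s - w i) / (\<Prod>s\<in>F. x s - x i) * P"
    unfolding F(3) P_def
    by (subst prod_pairs_insert[OF F(1,2)]) (simp_all add: hsym)
  have "(\<Prod>s\<in>F. h k' i s) = (\<Prod>s\<in>F. w s - q * w i) / (\<Prod>s\<in>F. x s - x i)"
    unfolding prod_dividef[symmetric]
    by (rule prod.cong) (simp_all add: h_def w_def k'F k'i mult_ac)
  then have A': "(\<Prod>(r, s)\<in>pairs I. h k' r s) = (\<Prod>s\<in>F. w s - q * w i) / (\<Prod>s\<in>F. x s - x i) * P"
    unfolding F(3) P'[symmetric]
    by (subst prod_pairs_insert[OF F(1,2)]) (simp_all add: hsym)
  define u where "u k r = (\<Prod>s\<in>I. \<Prod>t<k r. (x s - a s * x r * q ^ t) / (x s - x r * q ^ Suc t))"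
    for k :: "nat \<Rightarrow> nat" and r
  define v where "v k r = (\<Prod>t<k r. (D - E * x r * q ^ t) / (1 - x r * q ^ t))"
    for k :: "nat \<Rightarrow> nat" and r
  have F': "(\<Prod>r\<in>F. u k' r) = (\<Prod>r\<in>F. u k r)" "(\<Prod>r\<in>F. v k' r) = (\<Prod>r\<in>F. v k r)"
    by (simp_all add: u_def v_def k'F)
  have ui: "u k' i = u k i * ((\<Prod>s\<in>I. x s - a s * w i) / (\<Prod>s\<in>I. x s - q * w i))"
    by (simp add: u_def k'i prod.distrib w_def prod_dividef mult_ac)
  have vi: "v k' i = v k i * ((D - E * w i) / (1 - w i))"
    by (simp add: v_def k'i w_def mult_ac)
  have x0: "(\<Prod>s\<in>I. x s - q * w i) \<noteq> 0"
  proof -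
    have "x i * q ^ Suc (k i) \<noteq> x s" if "s \<in> I" for s
      using nr i that unfolding nonresonant_def by blast
    then have "x s - q * w i \<noteq> 0" if "s \<in> I" for s
      using that by (fastforce simp: w_def mult_ac)
    then show ?thesis using fin by simp
  qed
  have wi1: "1 - w i \<noteq> 0" using x1[of "k i"] by (simp add: w_def)
  have V: "milne_term I q a x D E k = (\<Prod>(r, s)\<in>pairs I. h k r s) * (\<Prod>r\<in>I. u k r) * (\<Prod>r\<in>I. v k r)" for k
    by (simp add: milne_term_def milne_weight_def h_def u_def v_def)
  have ins: "(\<Prod>r\<in>I. f r) = f i * (\<Prod>r\<in>F. f r)" for f :: "nat \<Rightarrow> complex"
    unfolding F(3) using F(1,2) by simp
  \<comment> \<open>\<open>W\<close> and \<open>W'\<close> are the products of node differences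
    before and after the raise, and \<open>M\<close> is the new denominator in row \<open>i\<close>.
    Only these three have to be cancelled.\<close>
  have alg: "(W' / X * P) * (U * (N / M) * UF) * (V * (d / e) * VF) * M / W' =
     (W / X * P) * (U * UF) * (V * VF) * (N * d) / (e * W)"
    if "W \<noteq> 0" "W' \<noteq> 0" "M \<noteq> 0" for W W' X P U N M UF V d e VF :: complex
    using that by simp
  show ?thesis
    unfolding V A A' ins[of "u k'"] ins[of "v k'"] ins[of "u k"] ins[of "v k"] F' ui vi F_def[symmetric]
    by (rule alg) (fact dw x0)+
qed

lemma prod_shift_ratio:
  fixes y q :: complex
  shows "(\<Prod>t<k. 1 - q * y * q ^ t) * (1 - y) = (\<Prod>t<k. 1 - y * q ^ t) * (1 - y * q ^ k)"
proof (induction k)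
  case (Suc k)
  have "(\<Prod>t<Suc k. 1 - q * y * q ^ t) * (1 - y) = (1 - q * y * q ^ k) * ((\<Prod>t<k. 1 - q * y * q ^ t) * (1 - y))"
    by simp
  then show ?case unfolding Suc by (simp add: mult_ac)
qed simp

text \<open>Every factor is homogeneous of degree 0 in \<open>x\<close>. This serves both for
  passing from \<open>x i\<close> to \<open>b * x i\<close> and for the step to
  \<open>q * x i\<close> in the recursion.\<close>

lemma milne_weight_scale:
  assumes "c \<noteq> 0"
  shows "milne_weight I q a (\<lambda>s. c * x s) k = milne_weight I q a x k"
proof -
  have 1: "(c * u * e - c * v * d) / (c * u - c * v) = (u * e - v * d) / (u - v)" for u v d e
    using assms by (simp add: mult.assoc flip: right_diff_distrib)
  have 2: "(c * u - g * (c * v) * d) / (c * u - c * v * e) = (u - g * v * d) / (u - v * e)"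
    for u v d e g
    using assms by (simp add: mult.assoc mult.left_commute[of g c] flip: right_diff_distrib)
  show ?thesis unfolding milne_weight_def 1 2 ..
qed

text \<open>With \<open>x\<close> and \<open>D\<close> scaled but not \<open>E\<close>, every
  numerator factor gains exactly one \<open>q\<close>, while the denominators telescope. The
  resulting quotient over \<open>1 - x s * q ^ k s\<close> is the one contributed by the node
  \<open>1\<close> in \<open>partial_fraction_unshift\<close>.\<close>

lemma milne_term_scale:
  assumes q: "q \<noteq> 0" and x1: "\<And>i t. i \<in> I \<Longrightarrow> x i * q ^ t \<noteq> 1"
  shows "milne_term I q a (\<lambda>s. q * x s) (q * D) E k =
    milne_term I q a x D E k * q ^ (\<Sum>i\<in>I. k i) * ((\<Prod>s\<in>I. 1 - x s) / (\<Prod>s\<in>I. 1 - x s * q ^ k s))"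
proof -
  have "(\<Prod>t<k i. (q * D - E * (q * x i) * q ^ t) / (1 - q * x i * q ^ t)) =
     (\<Prod>t<k i. (D - E * x i * q ^ t) / (1 - x i * q ^ t)) * q ^ k i * ((1 - x i) / (1 - x i * q ^ k i))"
    if i: "i \<in> I" for i
  proof -
    have nz: "(\<Prod>t<k i. 1 - x i * q ^ t) \<noteq> 0" "1 - x i * q ^ k i \<noteq> 0" "1 - x i \<noteq> 0"
      using x1[OF i] x1[OF i, of 0] by auto
    have eq: "(\<Prod>t<k i. 1 - q * x i * q ^ t) = (\<Prod>t<k i. 1 - x i * q ^ t) * (1 - x i * q ^ k i) / (1 - x i)"
      using prod_shift_ratio[of q "x i" "k i"] nz by (simp add: field_simps)
    have "(\<Prod>t<k i. q * D - E * (q * x i) * q ^ t) = (\<Prod>t<k i. q * (D - E * x i * q ^ t))"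
      by (simp add: algebra_simps)
    also have "\<dots> = q ^ k i * (\<Prod>t<k i. D - E * x i * q ^ t)"
      by (simp add: prod.distrib)
    finally show ?thesis
      unfolding prod_dividef eq using nz by simp
  qed
  then show ?thesis
    unfolding milne_term_def milne_weight_scale[OF q]
    by (simp add: prod.distrib power_sum prod_dividef)
qed

section \<open>Recursion of the finite sums in the degree\<close>

lemma sum_compositions_Suc:
  fixes g :: "nat \<Rightarrow> (nat \<Rightarrow> nat) \<Rightarrow> complex"
  assumes fin: "finite I" and zero: "\<And>i k. i \<in> I \<Longrightarrow> k i = 0 \<Longrightarrow> g i k = 0"
  shows "(\<Sum>k\<in>compositions I (Suc N). \<Sum>i\<in>I. g i k)
       = (\<Sum>k\<in>compositions I N. \<Sum>i\<in>I. g i (k(i := Suc (k i))))"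
proof -
  have "(\<Sum>k\<in>compositions I (Suc N). g i k) = (\<Sum>k\<in>compositions I N. g i (k(i := Suc (k i))))"
    if i: "i \<in> I" for i
  proof -
    have "(\<Sum>k\<in>compositions I (Suc N). g i k) = (\<Sum>k\<in>{k \<in> compositions I (Suc N). k i > 0}. g i k)"
      using finite_compositions[OF fin] zero[OF i] by (intro sum.mono_neutral_right) auto
    also have "\<dots> = (\<Sum>k\<in>compositions I N. g i (k(i := Suc (k i))))"
      by (rule sum.reindex_bij_betw[OF compositions_Suc_positive[OF fin i], symmetric])
    finally show ?thesis .
  qed
  then show ?thesis by (subst (1 2) sum.swap) simp
qed

text \<open>The factor \<open>1 / q ^ Suc N - 1\<close> is expanded over the nodes by
  \<open>partial_fraction_shift\<close>, each summand is moved down to degree \<open>N\<close> by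
  lowering its own \<open>k i\<close>, and the sum over \<open>i\<close> is then collected again by
  \<open>partial_fraction_unshift\<close>.\<close>

lemma milne_sum_Suc:
  fixes a x :: "nat \<Rightarrow> complex" and E :: complex
  assumes fin: "finite I" and q: "q \<noteq> 0" and nr: "nonresonant I q x"
    and x1: "\<And>i t. i \<in> I \<Longrightarrow> x i * q ^ t \<noteq> 1"
  defines "S \<equiv> \<lambda>N x D. \<Sum>k\<in>compositions I N. milne_term I q a x D E k"
  shows "(1 - q ^ Suc N) * S (Suc N) x D =
     (D - (\<Prod>s\<in>I. a s) * E * q ^ N) * S N x D
     + (E - D) * ((\<Prod>s\<in>I. a s - x s) / (\<Prod>s\<in>I. 1 - x s)) * S N (\<lambda>s. q * x s) (q * D)"
proof -
  define y where "y k s = x s * q ^ k s" for k :: "nat \<Rightarrow> nat" and s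
  have x0: "x i \<noteq> 0" if "i \<in> I" for i using nr that by (auto simp: nonresonant_def)
  have y0: "y k i \<noteq> 0" if "i \<in> I" for i k using x0 that q by (simp add: y_def)
  have y1: "y k i \<noteq> 1" if "i \<in> I" for i k using x1 that by (simp add: y_def)
  have inj: "inj_on (y k) I" for k
    using nonresonant_shifts_distinct[OF nr q] by (auto simp: inj_on_def y_def)
  have px: "(\<Prod>s\<in>I. x s) \<noteq> 0" "(\<Prod>s\<in>I. 1 - x s) \<noteq> 0"
    using x0 x1[of _ 0] fin by auto
  have py: "(\<Prod>s\<in>I. x s) / (\<Prod>s\<in>I. y k s) = 1 / q ^ M" if "k \<in> compositions I M" for k M
    using that px by (simp add: y_def prod.distrib compositions_def flip: power_sum)
  define g where "g i k = milne_term I q a x D E k * ((\<Prod>s\<in>I. x s - y k i) / (y k i * (\<Prod>s\<in>I-{i}. y k s - y k i)))"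
    for i k
  \<comment> \<open>For \<open>k i = 0\<close> the node \<open>y k i\<close> is \<open>x i\<close>
    itself, so the factor \<open>s = i\<close> of the numerator vanishes. Hence no summand is lost
    when \<open>k i\<close> is lowered.\<close>
  have gz: "g i k = 0" if "i \<in> I" "k i = 0" for i k
    using that fin by (force simp: g_def y_def)
  have gs: "g i (k(i := Suc (k i))) = milne_term I q a x D E k / q *
      ((\<Prod>s\<in>I. x s - a s * y k i) * (D - E * y k i) / (y k i * (1 - y k i) * (\<Prod>s\<in>I-{i}. y k s - y k i)))"
    if i: "i \<in> I" for i k
  proof -
    have *: "(\<Prod>s\<in>I-{i}. y (k(i := Suc (k i))) s - q * y k i) = (\<Prod>s\<in>I-{i}. y k s - q * y k i)"
      by (rule prod.cong) (auto simp: y_def)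
    have **: "y (k(i := Suc (k i))) i = q * y k i" by (simp add: y_def)
    have "g i (k(i := Suc (k i))) = (milne_term I q a x D E (k(i := Suc (k i))) *
        (\<Prod>s\<in>I. x s - q * y k i) / (\<Prod>s\<in>I-{i}. y k s - q * y k i)) / (q * y k i)"
      unfolding g_def ** * by simp
    also have "\<dots> = (milne_term I q a x D E k * ((\<Prod>s\<in>I. x s - a s * y k i) * (D - E * y k i)) /
         ((1 - y k i) * (\<Prod>s\<in>I-{i}. y k s - y k i))) / (q * y k i)"
      using milne_term_raise[OF fin q nr i x1[OF i], of a D E k] unfolding y_def by simp
    finally show ?thesis by simp
  qed
  \<comment> \<open>Rewritten so that the bracket is the right side of
    \<open>partial_fraction_shift\<close>.\<close>
  have "(1 - q ^ Suc N) * S (Suc N) x D =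
      q ^ Suc N * (\<Sum>k\<in>compositions I (Suc N). milne_term I q a x D E k * (1 / q ^ Suc N - 1))"
  proof -
    have *: "(1 - Q) * T = Q * (T * (1 / Q - 1))" if "Q \<noteq> 0" for Q T :: complex
      using that by (simp add: field_simps)
    show ?thesis unfolding S_def sum_distrib_right[symmetric] by (rule *) (use q in simp)
  qed
  also have "(\<Sum>k\<in>compositions I (Suc N). milne_term I q a x D E k * (1 / q ^ Suc N - 1)) =
      (\<Sum>k\<in>compositions I (Suc N). \<Sum>i\<in>I. g i k)"
  proof (rule sum.cong)
    fix k assume k: "k \<in> compositions I (Suc N)"
    show "milne_term I q a x D E k * (1 / q ^ Suc N - 1) = (\<Sum>i\<in>I. g i k)"
      unfolding g_def sum_distrib_left[symmetric] py[OF k, symmetric]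
      by (subst partial_fraction_shift) (use fin y0 inj in auto)
  qed simp
  also have "\<dots> = (\<Sum>k\<in>compositions I N. \<Sum>i\<in>I. g i (k(i := Suc (k i))))"
    by (rule sum_compositions_Suc[OF fin gz])
  also have "\<dots> = (\<Sum>k\<in>compositions I N. milne_term I q a x D E k / q *
      (D / q ^ N - E * (\<Prod>s\<in>I. a s) + (E - D) * (\<Prod>s\<in>I. a s - x s) / (\<Prod>s\<in>I. 1 - y k s)))"
  proof (rule sum.cong)
    fix k assume k: "k \<in> compositions I N"
    have *: "D * (\<Prod>s\<in>I. x s) / (\<Prod>s\<in>I. y k s) = D / q ^ N"
      using py[OF k] by (metis times_divide_eq_right mult.right_neutral)
    show "(\<Sum>i\<in>I. g i (k(i := Suc (k i)))) = milne_term I q a x D E k / q *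
      (D / q ^ N - E * (\<Prod>s\<in>I. a s) + (E - D) * (\<Prod>s\<in>I. a s - x s) / (\<Prod>s\<in>I. 1 - y k s))"
      unfolding *[symmetric]
      by (subst partial_fraction_unshift[symmetric]) (use fin y0 y1 inj in \<open>simp_all add: gs sum_distrib_left del: times_divide_eq_right times_divide_eq_left cong: sum.cong\<close>)
  qed simp
  \<comment> \<open>The first two terms of \<open>partial_fraction_unshift\<close> merge into the
    factor of the unshifted sum. The third is a term at \<open>(q x, q D)\<close> by
    \<open>milne_term_scale\<close>.\<close>
  also have "q ^ Suc N * \<dots> = (\<Sum>k\<in>compositions I N. (D - (\<Prod>s\<in>I. a s) * E * q ^ N) * milne_term I q a x D E k
     + (E - D) * ((\<Prod>s\<in>I. a s - x s) / (\<Prod>s\<in>I. 1 - x s)) * milne_term I q a (\<lambda>s. q * x s) (q * D) E k)"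
    unfolding sum_distrib_left
  proof (rule sum.cong)
    fix k assume k: "k \<in> compositions I N"
    then have N: "(\<Sum>i\<in>I. k i) = N" by (simp add: compositions_def)
    have nz: "(\<Prod>s\<in>I. 1 - y k s) \<noteq> 0" using y1 fin by auto
    have alg: "q * qN * (T / q * (D / qN - E * A + (E - D) * P / Y)) =
       (D - A * E * qN) * T + (E - D) * (P / X) * (T * qN * (X / Y))"
      if "qN \<noteq> 0" "X \<noteq> 0" "Y \<noteq> 0" for qN T A P X Y
      using that q by (simp add: field_simps)
    have sc: "milne_term I q a (\<lambda>s. q * x s) (q * D) E k =
        milne_term I q a x D E k * q ^ N * ((\<Prod>s\<in>I. 1 - x s) / (\<Prod>s\<in>I. 1 - y k s))"
      unfolding N[symmetric] y_def using q x1 by (intro milne_term_scale) auto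
    show "q ^ Suc N * (milne_term I q a x D E k / q *
      (D / q ^ N - E * (\<Prod>s\<in>I. a s) + (E - D) * (\<Prod>s\<in>I. a s - x s) / (\<Prod>s\<in>I. 1 - y k s))) =
      (D - (\<Prod>s\<in>I. a s) * E * q ^ N) * milne_term I q a x D E k
     + (E - D) * ((\<Prod>s\<in>I. a s - x s) / (\<Prod>s\<in>I. 1 - x s)) * milne_term I q a (\<lambda>s. q * x s) (q * D) E k"
      unfolding sc power_Suc
      by (rule alg) (use nz px q in auto)
  qed simp
  also have "\<dots> = (D - (\<Prod>s\<in>I. a s) * E * q ^ N) * S N x D
     + (E - D) * ((\<Prod>s\<in>I. a s - x s) / (\<Prod>s\<in>I. 1 - x s)) * S N (\<lambda>s. q * x s) (q * D)"
    by (simp only: S_def sum.distrib sum_distrib_left)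
  finally show ?thesis .
qed

section \<open>Solving the recursion: closed form of the finite sums\<close>

definition lowered_product ::
  "nat set \<Rightarrow> complex \<Rightarrow> (nat \<Rightarrow> complex) \<Rightarrow> (nat \<Rightarrow> complex) \<Rightarrow> nat \<Rightarrow> complex"
where
  "lowered_product I q a x d = (\<Prod>s\<in>I. \<Prod>t<d. (a s - x s * q ^ t) / (1 - x s * q ^ t))"

text \<open>Splitting off \<open>t = 0\<close> exposes the prefactor that stands before the shifted
  sum in \<open>milne_sum_Suc\<close>.\<close>

lemma lowered_product_Suc:
  "lowered_product I q a x (Suc d) =
     (\<Prod>s\<in>I. a s - x s) / (\<Prod>s\<in>I. 1 - x s) * lowered_product I q a (\<lambda>s. q * x s) d"
  by (simp add: lowered_product_def prod.lessThan_Suc_shift prod.distrib prod_dividef mult_ac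
      del: prod.lessThan_Suc)

lemma qpoch_Suc: "qpoch q z (Suc k) = qpoch q z k * (1 - z * q ^ k)"
  by (simp add: qpoch_def)

lemma nonresonant_scale:
  assumes "c \<noteq> 0" and "nonresonant I q x"
  shows "nonresonant I q (\<lambda>s. c * x s)"
proof -
  have "inj_on (\<lambda>s. c * x s) I"
    using assms by (simp add: nonresonant_def inj_on_def)
  moreover have "c * x i * q ^ Suc m \<noteq> c * x j" if "i \<in> I" "j \<in> I" for i j m
  proof -
    have "x i * q ^ Suc m \<noteq> x j" using assms(2) that unfolding nonresonant_def by blast
    then show ?thesis using assms(1) by (simp only: mult.assoc mult_cancel_left) simp
  qed
  ultimately show ?thesis using assms unfolding nonresonant_def by simp
qed

lemma qpoch_self_nonzero:
  assumes "norm q < 1"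
  shows "qpoch q q k \<noteq> 0"
proof -
  have "norm (q ^ Suc i) < 1" for i
    using assms by (simp add: norm_power power_less_one_iff power_Suc_less_one del: power_Suc)
  then have "q ^ Suc i \<noteq> 1" for i by (metis norm_one less_irrefl)
  then show ?thesis by (auto simp: qpoch_def)
qed

text \<open>\<open>A\<close> stands for the product of the \<open>a s\<close>. The formula is meant
  for \<open>d \<le> N\<close>: beyond that, truncated subtraction leaves an empty first product and
  not the value 0, hence the case distinction in the recursion below.\<close>

definition milne_coeff :: "complex \<Rightarrow> complex \<Rightarrow> complex \<Rightarrow> complex \<Rightarrow> nat \<Rightarrow> nat \<Rightarrow> complex" where
  "milne_coeff q A D E N d = (\<Prod>t<N-d. D - A * E * q ^ t) / qpoch q q (N - d) *
     ((\<Prod>t<d. E - D * q ^ t) / qpoch q q d)"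

lemma milne_coeff_0: "milne_coeff q A D E N 0 = (\<Prod>t<N. D - A * E * q ^ t) / qpoch q q N"
  by (simp add: milne_coeff_def qpoch_def)

lemma milne_coeff_Suc_0:
  assumes "norm q < 1"
  shows "(1 - q ^ Suc N) * milne_coeff q A D E (Suc N) 0 = (D - A * E * q ^ N) * milne_coeff q A D E N 0"
  using qpoch_self_nonzero[OF assms, of "Suc N"] by (simp add: milne_coeff_0 qpoch_Suc field_simps)

lemma milne_coeff_Suc_Suc:
  assumes q: "norm q < 1" and d: "d \<le> N"
  shows "(1 - q ^ Suc N) * milne_coeff q A D E (Suc N) (Suc d) =
     (D - A * E * q ^ N) * (if d < N then milne_coeff q A D E N (Suc d) else 0)
     + (E - D) * milne_coeff q A (q * D) E N d"
proof -
  have F: "(\<Prod>t<Suc d. E - D * q ^ t) = (E - D) * (\<Prod>t<d. E - q * D * q ^ t)"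
    by (simp add: prod.lessThan_Suc_shift mult_ac del: prod.lessThan_Suc)
  note nz = qpoch_self_nonzero[OF q]
  show ?thesis
  proof (cases "d < N")
    case False
    then have "d = N" using d by simp
    then show ?thesis
      using nz[of "Suc N"] unfolding milne_coeff_def F by (simp add: qpoch_Suc qpoch_def[of q q 0] field_simps)
  next
    case True
    then obtain m where m: "N = Suc (d + m)" using less_imp_Suc_add by auto
    define P where "P = (\<Prod>t<m. D - A * E * q ^ t)"
    have P': "(\<Prod>t<Suc m. q * D - A * E * q ^ t) = (q * D - A * E) * (q ^ m * P)"
    proof -
      have "(\<Prod>t<Suc m. q * D - A * E * q ^ t) = (q * D - A * E) * (\<Prod>t<m. q * (D - A * E * q ^ t))"
        by (simp add: prod.lessThan_Suc_shift algebra_simps del: prod.lessThan_Suc)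
      then show ?thesis by (simp add: P_def prod.distrib)
    qed
    have P: "(\<Prod>t<Suc m. D - A * E * q ^ t) = P * (D - A * E * q ^ m)" by (simp add: P_def)
    define R where "R = (\<Prod>t<d. E - q * D * q ^ t)"
    have nm: "Suc (Suc (d + m)) - Suc d = Suc m" "Suc (d + m) - Suc d = m" "Suc (d + m) - d = Suc m"
      by simp_all
    have nz': "1 - q * q ^ m \<noteq> 0" "1 - q * q ^ d \<noteq> 0"
      using nz[of "Suc m"] nz[of "Suc d"] by (auto simp: qpoch_Suc)
    have alg: "(1 - q * (q * (qd * qm))) * (P * (D - A * E * qm) / (M * (1 - q * qm)) * ((E - D) * R / (L * (1 - q * qd))))
      = (D - A * E * (q * (qd * qm))) * (P / M * ((E - D) * R / (L * (1 - q * qd))))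
       + (E - D) * ((q * D - A * E) * (qm * P) / (M * (1 - q * qm)) * (R / L))"
      if "M \<noteq> 0" "L \<noteq> 0" "1 - q * qm \<noteq> 0" "1 - q * qd \<noteq> 0" for qm qd M L
    proof -
      \<comment> \<open>With \<open>N = d + m + 1\<close>, \<open>qd = q ^ d\<close> and
        \<open>qm = q ^ m\<close>, this polynomial identity is the whole content of the recursion;
        everything else is a common factor.\<close>
      have *: "(1 - q * (q * (qd * qm))) * (D - A * E * qm) =
         (D - A * E * (q * (qd * qm))) * (1 - q * qm) + (q * D - A * E) * qm * (1 - q * qd)"
        by (simp add: algebra_simps)
      have **: "(X * u + Z * v) * (T / (M * L * u * v)) = X * (T / (M * L * v)) + Z * (T / (M * L * u))"
        if "u \<noteq> 0" "v \<noteq> 0" for X Z T u v :: complex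
        using that by (simp add: distrib_right add_divide_distrib mult.assoc)
      have "(1 - q * (q * (qd * qm))) * (P * (D - A * E * qm) / (M * (1 - q * qm)) * ((E - D) * R / (L * (1 - q * qd))))
         = ((1 - q * (q * (qd * qm))) * (D - A * E * qm)) * (P * (E - D) * R / (M * L * (1 - q * qm) * (1 - q * qd)))"
        by (simp add: mult_ac)
      also have "\<dots> = (D - A * E * (q * (qd * qm))) * (P / M * ((E - D) * R / (L * (1 - q * qd))))
       + (E - D) * ((q * D - A * E) * (qm * P) / (M * (1 - q * qm)) * (R / L))"
        unfolding * **[OF that(3,4)] by (simp add: mult_ac)
      finally show ?thesis .
    qed
    show ?thesis
      using True unfolding m milne_coeff_def nm P P' F P_def[symmetric] R_def[symmetric] qpoch_Suc power_Suc power_add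
      by (simp only: if_True, intro alg nz nz')
  qed
qed

text \<open>Induction on \<open>N\<close> with \<open>x\<close> and \<open>D\<close> free, since the
  recursion also calls the sum at \<open>(q x, q D)\<close>. There
  \<open>lowered_product_Suc\<close> absorbs the prefactor and moves \<open>d\<close> to
  \<open>Suc d\<close>, so that only the recursions of the coefficients remain.\<close>

theorem milne_sum:
  assumes fin: "finite I" and q0: "q \<noteq> 0" and q: "norm q < 1" and nr: "nonresonant I q x"
    and x1: "\<And>i t. i \<in> I \<Longrightarrow> x i * q ^ t \<noteq> 1"
  shows "(\<Sum>k\<in>compositions I N. milne_term I q a x D E k) =
     (\<Sum>d\<le>N. milne_coeff q (\<Prod>s\<in>I. a s) D E N d * lowered_product I q a x d)"
  using nr x1
proof (induction N arbitrary: x D)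
  case 0
  \<comment> \<open>Injectivity of \<open>x\<close> is used here: a quotient \<open>0 / 0\<close>
    would have the value 0.\<close>
  have "(\<Prod>(r, s)\<in>pairs I. (x s - x r) / (x s - x r)) = 1"
    using 0 by (intro prod.neutral) (auto simp: pairs_def nonresonant_def inj_on_def)
  then have "milne_term I q a x D E (restrict (\<lambda>_. 0) I) = 1"
    by (simp add: milne_term_def milne_weight_def pairs_def case_prod_unfold)
  then have "(\<Sum>k\<in>compositions I 0. milne_term I q a x D E k) = 1"
    unfolding compositions_0[OF fin] by (simp only: sum.insert_if sum.empty finite.emptyI empty_iff if_False add_0_right)
  then show ?case
    by (simp add: milne_coeff_0 lowered_product_def qpoch_def)
next
  case (Suc N)
  define A where "A = (\<Prod>s\<in>I. a s)"
  define L where "L = lowered_product I q a"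
  define r where "r = (\<Prod>s\<in>I. a s - x s) / (\<Prod>s\<in>I. 1 - x s)"
  have x1': "q * x i * q ^ t \<noteq> 1" if "i \<in> I" for i t
    using Suc.prems(2)[OF that, of "Suc t"] by (simp add: mult_ac)
  have "(1 - q ^ Suc N) * (\<Sum>k\<in>compositions I (Suc N). milne_term I q a x D E k) =
     (D - A * E * q ^ N) * (\<Sum>d\<le>N. milne_coeff q A D E N d * L x d)
     + (E - D) * r * (\<Sum>d\<le>N. milne_coeff q A (q * D) E N d * L (\<lambda>s. q * x s) d)"
    using milne_sum_Suc[OF fin q0 Suc.prems, of N a D E]
      Suc.IH[OF Suc.prems, of D] Suc.IH[OF nonresonant_scale[OF q0 Suc.prems(1)] x1', of "q * D"]
    by (simp add: A_def L_def r_def)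
  also have "(E - D) * r * (\<Sum>d\<le>N. milne_coeff q A (q * D) E N d * L (\<lambda>s. q * x s) d) =
      (\<Sum>d\<le>N. (E - D) * milne_coeff q A (q * D) E N d * L x (Suc d))"
    by (simp add: sum_distrib_left L_def lowered_product_Suc r_def mult_ac)
  also have "(\<Sum>d\<le>N. milne_coeff q A D E N d * L x d) =
      milne_coeff q A D E N 0 * L x 0 +
      (\<Sum>d\<le>N. (if d < N then milne_coeff q A D E N (Suc d) else 0) * L x (Suc d))"
  proof (cases N)
    case (Suc M)
    have "(\<Sum>d\<le>Suc M. (if d < Suc M then milne_coeff q A D E (Suc M) (Suc d) else 0) * L x (Suc d))
      = (\<Sum>d\<le>M. milne_coeff q A D E (Suc M) (Suc d) * L x (Suc d))"
      by simp
    then show ?thesis unfolding Suc by (simp only: sum.atMost_Suc_shift)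
  qed simp
  also have "(D - A * E * q ^ N) * (milne_coeff q A D E N 0 * L x 0 +
      (\<Sum>d\<le>N. (if d < N then milne_coeff q A D E N (Suc d) else 0) * L x (Suc d))) +
      (\<Sum>d\<le>N. (E - D) * milne_coeff q A (q * D) E N d * L x (Suc d)) =
      (1 - q ^ Suc N) * milne_coeff q A D E (Suc N) 0 * L x 0 +
      (\<Sum>d\<le>N. (1 - q ^ Suc N) * milne_coeff q A D E (Suc N) (Suc d) * L x (Suc d))"
  proof -
    have "(\<Sum>d\<le>N. (1 - q ^ Suc N) * milne_coeff q A D E (Suc N) (Suc d) * L x (Suc d)) =
      (\<Sum>d\<le>N. (D - A * E * q ^ N) * ((if d < N then milne_coeff q A D E N (Suc d) else 0) * L x (Suc d))
        + (E - D) * milne_coeff q A (q * D) E N d * L x (Suc d))"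
      by (rule sum.cong) (simp_all only: milne_coeff_Suc_Suc[OF q] atMost_iff, simp add: distrib_right)
    then show ?thesis
      unfolding milne_coeff_Suc_0[OF q] by (simp add: sum.distrib distrib_left flip: sum_distrib_left)
  qed
  also have "\<dots> = (1 - q ^ Suc N) * (\<Sum>d\<le>Suc N. milne_coeff q A D E (Suc N) d * L x d)"
    by (simp only: sum.atMost_Suc_shift distrib_left sum_distrib_left mult.assoc)
  finally have "(1 - q ^ Suc N) * (\<Sum>k\<in>compositions I (Suc N). milne_term I q a x D E k) =
    (1 - q ^ Suc N) * (\<Sum>d\<le>Suc N. milne_coeff q A D E (Suc N) d * L x d)" .
  moreover have "1 - q ^ Suc N \<noteq> 0"
    using qpoch_self_nonzero[OF q, of "Suc N"] by (simp add: qpoch_Suc)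
  ultimately show ?case unfolding A_def L_def by simp
qed

section \<open>Uniform bounds and Gaussian decay\<close>

section \<open>Bounds on q-factorials\<close>

lemma bounded_range_mult:
  fixes f g :: "'b \<Rightarrow> 'c::real_normed_algebra"
  assumes "bounded (range f)" "bounded (range g)"
  shows "bounded (range (\<lambda>k. f k * g k))"
proof -
  obtain B C where "\<And>k. norm (f k) \<le> B" "\<And>k. norm (g k) \<le> C"
    using assms by (auto simp: bounded_iff)
  then have "norm (f k * g k) \<le> B * C" for k
    by (intro order_trans[OF norm_mult_ineq] mult_mono') auto
  then show ?thesis by (auto simp: bounded_iff)
qed

lemma bounded_range_prod:
  fixes f :: "'d \<Rightarrow> 'b \<Rightarrow> 'c::{real_normed_algebra_1,comm_monoid_mult}"
  assumes "\<And>i. i \<in> I \<Longrightarrow> bounded (range (f i))"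
  shows "bounded (range (\<lambda>k. \<Prod>i\<in>I. f i k))"
  using assms
  by (induction I rule: infinite_finite_induct) (auto intro: bounded_range_mult simp: image_constant_conv)

lemma bounded_range_compose: "bounded (range f) \<Longrightarrow> bounded (range (\<lambda>k. f (g k)))"
  by (rule bounded_subset) auto

text \<open>By \<open>1 + y \<le> exp y\<close> the product is at most the exponential of a
  geometric sum. The bound depends on \<open>z\<close> only through \<open>c\<close>, so it also
  covers arguments that vary with the summation index.\<close>

lemma norm_qpoch_le:
  assumes "norm q < 1" and "norm z \<le> c"
  shows "norm (qpoch q z k) \<le> exp (c / (1 - norm q))"
proof -
  have c: "c \<ge> 0" using assms(2) norm_ge_zero order_trans by blast
  have "norm (qpoch q z k) = (\<Prod>i<k. norm (1 - z * q ^ i))"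
    by (simp add: qpoch_def prod_norm)
  also have "\<dots> \<le> (\<Prod>i<k. exp (c * norm q ^ i))"
  proof (rule prod_mono, rule conjI)
    fix i
    have "norm (1 - z * q ^ i) \<le> 1 + norm z * norm q ^ i"
      by (metis norm_triangle_ineq4 norm_one norm_mult norm_power)
    also have "\<dots> \<le> 1 + c * norm q ^ i"
      using assms by (intro add_left_mono mult_right_mono) auto
    also have "\<dots> \<le> exp (c * norm q ^ i)" by (rule exp_ge_add_one_self)
    finally show "norm (1 - z * q ^ i) \<le> exp (c * norm q ^ i)" .
  qed simp
  also have "\<dots> = exp (c * (\<Sum>i<k. norm q ^ i))"
    by (simp add: exp_sum sum_distrib_left)
  also have "\<dots> \<le> exp (c / (1 - norm q))"
  proof -
    have "(\<Sum>i<k. norm q ^ i) \<le> (\<Sum>i. norm q ^ i)"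
      using assms by (intro sum_le_suminf summable_geometric) auto
    also have "\<dots> = 1 / (1 - norm q)" using assms by (intro suminf_geometric) auto
    finally show ?thesis using c by (simp add: mult_left_mono divide_inverse)
  qed
  finally show ?thesis .
qed

lemma bounded_qpoch: "norm q < 1 \<Longrightarrow> bounded (range (qpoch q z))"
  using norm_qpoch_le[of q z "norm z"] by (auto simp: bounded_iff)

text \<open>The infinite product converges to a nonzero limit, so the reciprocals of the partial
  products converge and are bounded.\<close>

lemma bounded_inverse_qpoch:
  assumes "norm q < 1" and "\<And>k. qpoch q z k \<noteq> 0"
  shows "bounded (range (\<lambda>k. inverse (qpoch q z k)))"
proof -
  let ?f = "\<lambda>i. 1 - z * q ^ i"
  have nz: "?f i \<noteq> 0" for i using assms(2)[of "Suc i"] by (auto simp: qpoch_Suc)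
  have "summable (\<lambda>i. norm (?f i - 1))"
    using assms by (simp add: norm_mult norm_power)
  then have cp: "convergent_prod ?f"
    by (intro abs_convergent_prod_imp_convergent_prod summable_imp_abs_convergent_prod)
  have "(\<lambda>n. qpoch q z (Suc n)) \<longlonglongrightarrow> prodinf ?f"
    using convergent_prod_LIMSEQ[OF cp] by (simp add: qpoch_def lessThan_Suc_atMost)
  then have "(\<lambda>n. inverse (qpoch q z n)) \<longlonglongrightarrow> inverse (prodinf ?f)"
    using prodinf_nonzero[OF cp] nz by (intro tendsto_inverse) (auto simp: filterlim_sequentially_Suc)
  then show ?thesis using convergent_imp_bounded by blast
qed

lemma summable_power_gaussian:
  fixes L r :: real
  assumes "0 \<le> L" "0 \<le> r" "r < 1"
  shows "summable (\<lambda>n. L ^ n * r ^ (n choose 2))"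
proof -
  have "(\<lambda>n. L * r ^ n) \<longlonglongrightarrow> L * 0"
    using assms by (intro tendsto_intros LIMSEQ_realpow_zero) auto
  then have "eventually (\<lambda>n. L * r ^ n < 1/2) sequentially"
    by (intro order_tendstoD) auto
  then obtain N where N: "\<And>n. n \<ge> N \<Longrightarrow> L * r ^ n < 1/2"
    by (auto simp: eventually_sequentially)
  show ?thesis
  proof (rule summable_ratio_test[of "1/2" N])
    fix n assume "n \<ge> N"
    have "L ^ Suc n * r ^ (Suc n choose 2) = (L * r ^ n) * (L ^ n * r ^ (n choose 2))"
      by (simp add: numeral_2_eq_2 power_add mult_ac)
    also have "\<dots> \<le> 1/2 * (L ^ n * r ^ (n choose 2))"
      using N[OF \<open>n \<ge> N\<close>] assms by (intro mult_right_mono) auto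
    finally show "norm (L ^ Suc n * r ^ (Suc n choose 2)) \<le> 1/2 * norm (L ^ n * r ^ (n choose 2))"
      using assms by simp
  qed simp
qed

section \<open>The inner sums: \<open>q\<close>-binomial series and a telescoping series\<close>

section \<open>Two q-series\<close>

text \<open>The Gaussian binomial coefficient \<open>[d + m, m]\<close>, indexed by both parts so
  that it is symmetric and free of subtraction.\<close>

definition qbinom :: "complex \<Rightarrow> nat \<Rightarrow> nat \<Rightarrow> complex" where
  "qbinom q d m = qpoch q q (d + m) / (qpoch q q d * qpoch q q m)"

lemma qbinom_0 [simp]: "norm q < 1 \<Longrightarrow> qbinom q d 0 = 1" "norm q < 1 \<Longrightarrow> qbinom q 0 m = 1"
  using qpoch_self_nonzero[of q] by (auto simp: qbinom_def qpoch_def[of _ _ 0])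

text \<open>The two \<open>q\<close>-Pascal rules. Both are the same identity in
  \<open>u = q ^ Suc d\<close> and \<open>v = q ^ Suc m\<close>, with the two exchanged.\<close>

lemma qbinom_Suc_Suc:
  assumes "norm q < 1"
  shows "qbinom q (Suc d) (Suc m) = qbinom q d (Suc m) + q ^ Suc d * qbinom q (Suc d) m"
    and "qbinom q (Suc d) (Suc m) = q ^ Suc m * qbinom q d (Suc m) + qbinom q (Suc d) m"
proof -
  have nz: "qpoch q q k \<noteq> 0" "1 - q * q ^ k \<noteq> 0" for k
    using qpoch_self_nonzero[OF assms, of k] qpoch_self_nonzero[OF assms, of "Suc k"]
    by (simp_all add: qpoch_Suc)
  define u v P where "u = q * q ^ d" and "v = q * q ^ m"
    and "P = qpoch q q (Suc (d + m)) / (qpoch q q d * qpoch q q m)"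
  have uv: "1 - u \<noteq> 0" "1 - v \<noteq> 0" using nz by (auto simp: u_def v_def)
  have 1: "qbinom q (Suc d) (Suc m) = P * (1 - u * v) / ((1 - u) * (1 - v))"
    by (simp add: qbinom_def qpoch_Suc P_def u_def v_def power_add mult_ac)
  have 2: "qbinom q d (Suc m) = P / (1 - v)"
    by (simp add: qbinom_def qpoch_Suc P_def v_def mult_ac)
  have 3: "qbinom q (Suc d) m = P / (1 - u)"
    by (simp add: qbinom_def qpoch_Suc P_def u_def mult_ac)
  have alg: "P * (1 - u * v) / ((1 - u) * (1 - v)) = P / (1 - v) + u * (P / (1 - u))"
    if "1 - u \<noteq> 0" "1 - v \<noteq> 0" for u v P :: complex
  proof -
    have "P * (1 - u * v) = P * (1 - u) + u * P * (1 - v)" by (simp add: algebra_simps)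
    then show ?thesis using that by (simp add: add_divide_distrib)
  qed
  show "qbinom q (Suc d) (Suc m) = qbinom q d (Suc m) + q ^ Suc d * qbinom q (Suc d) m"
    unfolding 1 2 3 power_Suc u_def[symmetric] by (rule alg[OF uv])
  show "qbinom q (Suc d) (Suc m) = q ^ Suc m * qbinom q d (Suc m) + qbinom q (Suc d) m"
    unfolding 1 2 3 power_Suc v_def[symmetric] using alg[OF uv(2,1), of P] by (simp add: mult_ac)
qed

lemma bounded_qbinom:
  assumes "norm q < 1"
  obtains B where "B > 0" "\<And>d m. norm (qbinom q d m) \<le> B"
proof -
  obtain B where B: "B > 0" "\<And>k. norm (qpoch q q k) \<le> B"
    using bounded_qpoch[OF assms] by (auto simp: bounded_pos)
  obtain C where C: "C > 0" "\<And>k. norm (inverse (qpoch q q k)) \<le> C"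
    using bounded_inverse_qpoch[OF assms qpoch_self_nonzero[OF assms]] by (auto simp: bounded_pos)
  have "norm (qbinom q d m) \<le> B * (C * C)" for d m
  proof -
    have "norm (qbinom q d m) = norm (qpoch q q (d + m)) * (norm (inverse (qpoch q q d)) * norm (inverse (qpoch q q m)))"
      by (simp add: qbinom_def divide_inverse norm_mult)
    also have "\<dots> \<le> B * (C * C)"
      using B C by (intro mult_mono) (auto intro: less_imp_le)
    finally show ?thesis .
  qed
  moreover have "B * (C * C) > 0" using B C by simp
  ultimately show thesis using that by blast
qed

text \<open>By the first Pascal rule the sum \<open>S\<close> for \<open>Suc d\<close> satisfies
  \<open>S = 1 / qpoch q z (Suc d) + q ^ Suc d * z * S\<close>, which can be solved because
  \<open>norm (z * q ^ Suc d) < 1\<close>.\<close>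

lemma sums_qbinom:
  assumes q: "norm q < 1" and z: "norm z < 1"
  shows "(\<lambda>m. qbinom q d m * z ^ m) sums (1 / qpoch q z (Suc d))"
proof (induction d)
  case 0
  then show ?case
    using geometric_sums[OF z] q by (simp add: qpoch_def)
next
  case (Suc d)
  let ?f = "\<lambda>m. qbinom q (Suc d) m * z ^ m"
  obtain B where B: "B > 0" "\<And>d m. norm (qbinom q d m) \<le> B" using bounded_qbinom[OF q] by metis
  have "summable ?f"
  proof (rule summable_comparison_test')
    show "summable (\<lambda>m. B * norm z ^ m)" using z by simp
    show "norm (?f m) \<le> B * norm z ^ m" for m
      using B by (simp add: norm_mult norm_power mult_right_mono)
  qed
  then obtain S where S: "?f sums S" by (auto simp: summable_def)
  have "(\<lambda>m. qbinom q d (Suc m) * z ^ Suc m) sums (1 / qpoch q z (Suc d) - 1)"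
    using Suc q by (subst sums_Suc_iff) simp
  from sums_add[OF this sums_mult[OF S, of "q ^ Suc d * z"]]
  have "(\<lambda>m. ?f (Suc m)) sums (1 / qpoch q z (Suc d) - 1 + q ^ Suc d * z * S)"
    by (simp add: qbinom_Suc_Suc(1)[OF q] algebra_simps)
  then have "?f sums (1 / qpoch q z (Suc d) + q ^ Suc d * z * S)"
    using q by (subst (asm) sums_Suc_iff) simp
  then have "S = 1 / qpoch q z (Suc d) + q ^ Suc d * z * S"
    using S sums_unique2 by blast
  then have *: "S * (1 - z * q ^ Suc d) = 1 / qpoch q z (Suc d)" by (simp add: algebra_simps)
  have "norm (z * q ^ Suc d) < 1"
  proof -
    have "norm q ^ Suc d \<le> 1" using q by (intro power_le_one) auto
    then have "norm z * norm q ^ Suc d \<le> norm z * 1" by (intro mult_left_mono) auto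
    then show ?thesis using z by (simp add: norm_mult norm_power)
  qed
  then have "1 - z * q ^ Suc d \<noteq> 0" by (metis eq_iff_diff_eq_0 less_irrefl norm_one)
  then have "S = 1 / qpoch q z (Suc d) / (1 - z * q ^ Suc d)"
    using * by (metis nonzero_mult_div_cancel_right)
  then show ?case using S by (simp add: qpoch_Suc[of q z "Suc d"] del: power_Suc)
qed

text \<open>The summand of the inner sum on the right, with \<open>m = N - d\<close> and
  \<open>C = a z\<close>; see \<open>rhs_coeff\<close>.\<close>

definition unit_term :: "complex \<Rightarrow> complex \<Rightarrow> nat \<Rightarrow> nat \<Rightarrow> complex" where
  "unit_term q C d m = (1 - C * q ^ (2 * (d + m))) * qbinom q d m * qpoch q (C * q ^ (d + m)) d
     * C ^ m * q ^ (d * m + 2 * (m choose 2))"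

text \<open>
  The exponent \<open>2 (m choose 2)\<close> stands for \<open>m (m - 1)\<close>. The \<open>unit_certificate\<close> is the Gosper-type
  antidifference in \<open>m\<close> of the change under \<open>(d, C q) \<mapsto> (d + 1, C)\<close>; at \<open>m = 0\<close> the missing
  coefficient \<open>[d + m, m - 1]\<close> must be \<open>0\<close>, which truncated subtraction would not give.
\<close>

definition unit_certificate :: "complex \<Rightarrow> complex \<Rightarrow> nat \<Rightarrow> nat \<Rightarrow> complex" where
  "unit_certificate q C d m = - (q ^ Suc d * (if m = 0 then 0 else qbinom q (Suc d) (m - 1))
     * qpoch q (C * q ^ (d + m)) (Suc d) * C ^ m * q ^ (Suc d * m + 2 * (m choose 2)))"

lemma qpoch_Suc_left: "qpoch q z (Suc k) = (1 - z) * qpoch q (z * q) k"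
  by (simp add: qpoch_def prod.lessThan_Suc_shift mult_ac del: prod.lessThan_Suc)

text \<open>All four expressions share the factor \<open>X\<close>. The two Pascal rules in
  \<open>P\<close> turn \<open>B - qbinom q d m\<close> and \<open>B - v * qbinom q d m\<close> into
  multiples of the coefficient \<open>B'\<close> with \<open>m\<close> lowered, which yields
  \<open>key\<close>.\<close>

lemma unit_term_telescopes:
  assumes q: "norm q < 1"
  shows "unit_term q C (Suc d) m - unit_term q (C * q) d m =
     unit_certificate q C d (Suc m) - unit_certificate q C d m"
proof -
  define X where "X = C ^ m * q ^ (Suc d * m + 2 * (m choose 2)) * qpoch q (C * q ^ (Suc d + m)) d"
  define u v where "u = q * q ^ d" and "v = q ^ m"
  define B where "B = qbinom q (Suc d) m"
  define B' where "B' = (if m = 0 then 0 else qbinom q (Suc d) (m - 1))"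
  have P: "B = qbinom q d m + u * B'" "B = v * qbinom q d m + B'"
    using q qbinom_Suc_Suc[OF q, of d "m - 1"]
    by (cases m; simp add: B_def B'_def u_def v_def)+
  have c2: "Suc m choose 2 = (m choose 2) + m" by (simp add: numeral_2_eq_2)
  have t1: "unit_term q C (Suc d) m = (1 - C * u\<^sup>2 * v\<^sup>2) * B * (1 - C * u * v * q ^ d) * X"
  proof -
    have 1: "q ^ (2 * (Suc d + m)) = u\<^sup>2 * v\<^sup>2"
      by (simp add: u_def v_def power_add power_mult power2_eq_square mult_ac)
    show ?thesis
      unfolding unit_term_def 1 qpoch_Suc X_def B_def u_def v_def
      by (simp add: power_add mult_ac)
  qed
  have t2: "unit_term q (C * q) d m = (1 - C * u * v\<^sup>2 * q ^ d) * qbinom q d m * X"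
  proof -
    have 1: "C * q * q ^ (2 * (d + m)) = C * u * v\<^sup>2 * q ^ d"
      by (simp add: u_def v_def power_add power_mult power2_eq_square mult_ac)
    show ?thesis
      unfolding unit_term_def 1 X_def
      by (simp add: power_add power_mult_distrib mult_ac)
  qed
  have g1: "unit_certificate q C d m = - (u * B' * (1 - C * v * q ^ d) * X)"
    unfolding unit_certificate_def B'_def[symmetric] qpoch_Suc_left X_def
    by (simp add: power_add u_def v_def mult_ac)
  have g2: "unit_certificate q C d (Suc m) = - (C * u\<^sup>2 * v\<^sup>2 * B * (1 - C * u * v * q ^ d) * X)"
  proof -
    have 1: "qpoch q (C * q ^ (d + Suc m)) (Suc d) = qpoch q (C * q ^ (Suc d + m)) d * (1 - C * u * v * q ^ d)"
      unfolding qpoch_Suc by (simp add: power_add u_def v_def mult_ac)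
    have 2: "q ^ (Suc d * Suc m + 2 * (Suc m choose 2)) = q ^ (Suc d * m + 2 * (m choose 2)) * (u * v\<^sup>2)"
      unfolding c2 by (simp add: power_add power_mult power2_eq_square power3_eq_cube u_def v_def mult_ac)
    show ?thesis
      unfolding unit_certificate_def 1 2 X_def power_Suc u_def[symmetric]
      by (simp add: B_def mult_ac power2_eq_square)
  qed
  have key: "B * (1 - C * u * v * q ^ d) - (1 - C * u * v\<^sup>2 * q ^ d) * qbinom q d m
      = u * B' * (1 - C * v * q ^ d)"
  proof -
    have "B * (1 - C * u * v * q ^ d) - (1 - C * u * v\<^sup>2 * q ^ d) * qbinom q d m
      = (B - qbinom q d m) - C * u * v * q ^ d * (B - v * qbinom q d m)"
      by (simp add: algebra_simps power2_eq_square)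
    also have "\<dots> = u * B' - C * u * v * q ^ d * B'"
      using P by (metis add_diff_cancel_left')
    finally show ?thesis by (simp add: algebra_simps)
  qed
  have "unit_term q C (Suc d) m - unit_term q (C * q) d m - unit_certificate q C d (Suc m)
     = (B * (1 - C * u * v * q ^ d) - (1 - C * u * v\<^sup>2 * q ^ d) * qbinom q d m) * X"
    unfolding t1 t2 g2 by (simp add: algebra_simps)
  also have "\<dots> = - unit_certificate q C d m" unfolding key g1 by simp
  finally show ?thesis by (simp add: algebra_simps)
qed

lemma unit_certificate_tendsto_0:
  assumes q: "norm q < 1"
  shows "unit_certificate q C d \<longlonglongrightarrow> 0"
proof -
  obtain B where B: "B > 0" "\<And>d m. norm (qbinom q d m) \<le> B" using bounded_qbinom[OF q] by metis
  define K where "K = exp (norm C / (1 - norm q))"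
  have "summable (\<lambda>m. B * K * (norm C ^ m * norm q ^ (m choose 2)))"
    using q by (intro summable_mult summable_power_gaussian) auto
  then have lim: "(\<lambda>m. B * K * (norm C ^ m * norm q ^ (m choose 2))) \<longlonglongrightarrow> 0"
    by (rule summable_LIMSEQ_zero)
  have le: "norm (unit_certificate q C d m) \<le> B * K * (norm C ^ m * norm q ^ (m choose 2))" for m
  proof -
    have "norm (C * q ^ (d + m)) \<le> norm C"
      using q by (simp add: norm_mult norm_power mult_left_le power_le_one)
    then have 1: "norm (qpoch q (C * q ^ (d + m)) (Suc d)) \<le> K"
      unfolding K_def by (rule norm_qpoch_le[OF q])
    have 2: "norm (if m = 0 then 0 else qbinom q (Suc d) (m - 1)) \<le> B" using B by (auto intro: less_imp_le)
    have 3: "norm (q ^ Suc d) \<le> 1"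
      using q unfolding norm_power by (intro power_le_one) auto
    have 4: "norm (q ^ (Suc d * m + 2 * (m choose 2))) \<le> norm q ^ (m choose 2)"
      using q unfolding norm_power by (intro power_decreasing) auto
    have "norm (unit_certificate q C d m) = norm (q ^ Suc d) * norm (if m = 0 then 0 else qbinom q (Suc d) (m - 1))
       * norm (qpoch q (C * q ^ (d + m)) (Suc d)) * norm C ^ m * norm (q ^ (Suc d * m + 2 * (m choose 2)))"
      by (simp only: unit_certificate_def norm_minus_cancel norm_mult norm_power)
    also have "\<dots> \<le> 1 * B * K * norm C ^ m * norm q ^ (m choose 2)"
      using 1 2 3 4 B(1) by (intro mult_mono) (auto simp: K_def)
    finally show ?thesis by (simp add: mult_ac)
  qed
  show ?thesis by (rule Lim_null_comparison[OF always_eventually lim]) (use le in auto)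
qed

text \<open>Induction on \<open>d\<close> with \<open>C\<close> free: the sum at
  \<open>(Suc d, C)\<close> differs from the one at \<open>(d, C * q)\<close> by the boundary values
  of \<open>unit_certificate\<close>, which are 0 at \<open>m = 0\<close> and in the limit.\<close>

lemma sums_unit_term:
  assumes q: "norm q < 1"
  shows "unit_term q C d sums 1"
proof (induction d arbitrary: C)
  case 0
  \<comment> \<open>For \<open>d = 0\<close> the summand is \<open>?u m - ?u (Suc m)\<close>, since
    the exponent \<open>m (m - 1)\<close> grows by \<open>2 m\<close>.\<close>
  let ?u = "\<lambda>m. C ^ m * q ^ (2 * (m choose 2))"
  have "summable (\<lambda>m. norm C ^ m * norm (q\<^sup>2) ^ (m choose 2))"
    using q by (intro summable_power_gaussian) (auto simp: norm_power power_less_one_iff)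
  then have "(\<lambda>m. norm (?u m)) \<longlonglongrightarrow> 0"
    by (intro summable_LIMSEQ_zero) (simp add: norm_mult norm_power power_mult)
  then have "?u \<longlonglongrightarrow> 0" by (rule tendsto_norm_zero_cancel)
  then have "(\<lambda>m. ?u m - ?u (Suc m)) sums (?u 0 - 0)" by (rule telescope_sums')
  moreover have "?u m - ?u (Suc m) = unit_term q C 0 m" for m
    using q by (simp add: unit_term_def qpoch_def numeral_2_eq_2 power_add algebra_simps mult_2)
  ultimately show ?case by (simp add: numeral_2_eq_2)
next
  case (Suc d)
  have "(\<lambda>m. unit_certificate q C d (Suc m) - unit_certificate q C d m) sums (0 - unit_certificate q C d 0)"
    by (rule telescope_sums[OF unit_certificate_tendsto_0[OF q]])
  from sums_add[OF Suc[of "C * q"] this] show ?case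
    by (simp add: unit_term_telescopes[OF q, symmetric] unit_certificate_def[of _ _ _ 0])
qed

section \<open>Rearrangement of sums and growth of their factors\<close>

section \<open>Infinite sums over multi-indices\<close>

lemma summable_on_power_PiE:
  fixes c :: real
  assumes "finite I" and c: "0 \<le> c" "c < 1"
  shows "(\<lambda>k. c ^ (\<Sum>i\<in>I. k i)) summable_on (I \<rightarrow>\<^sub>E (UNIV :: nat set))"
proof -
  have "(\<lambda>m. c ^ m) summable_on (UNIV :: nat set)"
    using c by (subst summable_on_UNIV_nonneg_real_iff) auto
  then have "Infinite_Set_Sum.abs_summable_on (\<lambda>m. c ^ m) (UNIV :: nat set)"
    using c by (simp add: abs_summable_equivalent[symmetric])
  then have "Infinite_Set_Sum.abs_summable_on (\<lambda>k. \<Prod>i\<in>I. c ^ k i) (I \<rightarrow>\<^sub>E (UNIV :: nat set))"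
    using assms(1) by (intro abs_summable_on_prod_PiE) auto
  then show ?thesis
    using c by (simp add: abs_summable_equivalent[symmetric] power_sum prod_nonneg)
qed

lemma summable_on_norm_comparison:
  fixes f :: "'b \<Rightarrow> complex" and g :: "'b \<Rightarrow> real"
  assumes "g summable_on A" and "\<And>x. x \<in> A \<Longrightarrow> norm (f x) \<le> g x"
  shows "f summable_on A"
proof (rule abs_summable_summable)
  show "(\<lambda>x. norm (f x)) summable_on A"
    by (rule summable_on_comparison_test[OF assms(1)]) (use assms(2) in auto)
qed

lemma summable_on_product_bound:
  fixes g :: "nat \<times> nat \<Rightarrow> complex" and u v :: "nat \<Rightarrow> real"
  assumes u: "summable u" and v: "summable v" and nonneg: "\<And>d. 0 \<le> u d" "\<And>m. 0 \<le> v m"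
    and le: "\<And>d m. norm (g (d, m)) \<le> u d * v m"
  shows "g summable_on UNIV"
proof (rule summable_on_norm_comparison)
  have us: "u summable_on UNIV" and vs: "v summable_on UNIV"
    using u v nonneg by (simp_all add: summable_on_UNIV_nonneg_real_iff)
  have "(\<lambda>(d, m). u d * v m) summable_on (SIGMA d:UNIV. UNIV)"
  proof (rule summable_on_SigmaI[where g = "\<lambda>d. u d * infsum v UNIV"])
    show "((\<lambda>y. case (d, y) of (d, m) \<Rightarrow> u d * v m) has_sum u d * infsum v UNIV) UNIV" for d
      using has_sum_cmult_right[OF has_sum_infsum[OF vs]] by simp
    show "(\<lambda>d. u d * infsum v UNIV) summable_on UNIV"
      using us by (rule summable_on_cmult_left)
  qed (use nonneg in auto)
  then show "(\<lambda>(d, m). u d * v m) summable_on UNIV" by simp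
qed (use le in auto)

lemma infsum_fibres:
  fixes f :: "'b \<Rightarrow> complex" and h :: "'b \<Rightarrow> nat"
  assumes f: "f summable_on A"
  shows "infsum f A = (\<Sum>\<^sub>\<infinity>N. infsum f {x \<in> A. h x = N})"
proof -
  let ?S = "SIGMA N:UNIV. {x \<in> A. h x = N}"
  have bij: "bij_betw snd ?S A"
    by (rule bij_betwI[where g = "\<lambda>x. (h x, x)"]) auto
  have eq: "infsum (\<lambda>p. f (snd p)) ?S = infsum f A"
    by (rule infsum_reindex_bij_betw[OF bij])
  have "(\<lambda>p. f (snd p)) summable_on ?S"
    using summable_on_reindex_bij_betw[OF bij, of f] f by blast
  from infsum_Sigma_banach[OF this] show ?thesis unfolding eq by simp
qed

text \<open>Both sides are iterated forms of the same absolutely convergent double sum, once along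
  antidiagonals and once along rows.\<close>

lemma infsum_antidiagonals:
  fixes g :: "nat \<times> nat \<Rightarrow> complex"
  assumes g: "g summable_on UNIV" and T: "\<And>d. (\<lambda>m. g (d, m)) sums T d"
  shows "(\<Sum>\<^sub>\<infinity>N. \<Sum>d\<le>N. g (d, N - d)) = (\<Sum>\<^sub>\<infinity>d. T d)"
proof -
  have g': "g summable_on (SIGMA d:UNIV. UNIV)" using g by simp
  have "infsum g {p. fst p + snd p = N} = (\<Sum>d\<le>N. g (d, N - d))" for N
  proof -
    have "{p. fst p + snd p = N} = (\<lambda>d. (d, N - d)) ` {..N}"
      by (auto simp: image_iff)
    then show ?thesis by (simp add: sum.reindex inj_on_def)
  qed
  then have "(\<Sum>\<^sub>\<infinity>N. \<Sum>d\<le>N. g (d, N - d)) = infsum g UNIV"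
    using infsum_fibres[OF g, of "\<lambda>p. fst p + snd p"] by simp
  also have "\<dots> = (\<Sum>\<^sub>\<infinity>d. \<Sum>\<^sub>\<infinity>m. g (d, m))"
    using infsum_Sigma_banach[OF g'] by simp
  also have "\<dots> = (\<Sum>\<^sub>\<infinity>d. T d)"
  proof (rule infsum_cong)
    fix d :: nat
    have "(\<lambda>m. g (d, m)) summable_on UNIV"
      using g' by (intro summable_on_SigmaD1[of "\<lambda>d m. g (d, m)" UNIV]) auto
    then have "(\<lambda>m. g (d, m)) sums (\<Sum>\<^sub>\<infinity>m. g (d, m))"
      by (intro has_sum_imp_sums has_sum_infsum)
    then show "(\<Sum>\<^sub>\<infinity>m. g (d, m)) = T d" using T sums_unique2 by blast
  qed
  finally show ?thesis .
qed

text \<open>The pair factors are bounded since powers of \<open>q\<close> are, the rows since they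
  are quotients of \<open>q\<close>-factorials with nonvanishing denominators. Convergence is thus
  decided by the remaining factors of the series.\<close>

lemma bounded_milne_weight:
  assumes q: "norm q < 1" and fin: "finite I" and nr: "nonresonant I q x"
  shows "bounded (range (milne_weight I q a x))"
proof -
  have "bounded (range (\<lambda>k. case p of (r, s) \<Rightarrow> (x s * q ^ k s - x r * q ^ k r) / (x s - x r)))" for p
  proof -
    obtain r s where p: "p = (r, s)" by force
    have "norm ((x s * q ^ k s - x r * q ^ k r) / (x s - x r)) \<le> (norm (x s) + norm (x r)) / norm (x s - x r)" for k
    proof -
      have *: "norm (x i * q ^ k i) \<le> norm (x i)" for i
        using q by (simp add: norm_mult norm_power mult_left_le power_le_one)
      have "norm (x s * q ^ k s - x r * q ^ k r) \<le> norm (x s) + norm (x r)"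
        using *[of s] *[of r] norm_triangle_ineq4[of "x s * q ^ k s" "x r * q ^ k r"] by linarith
      then show ?thesis by (simp add: norm_divide divide_right_mono)
    qed
    then show ?thesis unfolding p by (auto simp: bounded_iff)
  qed
  then have 1: "bounded (range (\<lambda>k. \<Prod>(r, s)\<in>pairs I. (x s * q ^ k s - x r * q ^ k r) / (x s - x r)))"
    by (rule bounded_range_prod)
  have "bounded (range (\<lambda>k. \<Prod>t<k r. (x s - a s * x r * q ^ t) / (x s - x r * q ^ Suc t)))"
    if rs: "r \<in> I" "s \<in> I" for r s
  proof -
    have xs: "x s \<noteq> 0" using nr rs by (auto simp: nonresonant_def)
    have nz: "1 - q * x r / x s * q ^ t \<noteq> 0" for t
    proof -
      have "x r * q ^ Suc t \<noteq> x s" using nr rs unfolding nonresonant_def by blast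
      then show ?thesis using xs by (auto simp: field_simps)
    qed
    have "(\<Prod>t<m. (x s - a s * x r * q ^ t) / (x s - x r * q ^ Suc t)) =
       qpoch q (a s * x r / x s) m * inverse (qpoch q (q * x r / x s) m)" for m
    proof -
      have "(x s - a s * x r * q ^ t) / (x s - x r * q ^ Suc t) =
         (1 - a s * x r / x s * q ^ t) / (1 - q * x r / x s * q ^ t)" for t
      proof -
        have "x s - a s * x r * q ^ t = x s * (1 - a s * x r / x s * q ^ t)"
          "x s - x r * q ^ Suc t = x s * (1 - q * x r / x s * q ^ t)"
          using xs by (simp_all add: field_simps)
        then show ?thesis using xs by simp
      qed
      then show ?thesis by (simp add: qpoch_def prod_dividef divide_inverse[of "prod _ _"])
    qed
    moreover have "bounded (range (\<lambda>k. qpoch q (a s * x r / x s) (k r) * inverse (qpoch q (q * x r / x s) (k r))))"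
      using q nz
      by (intro bounded_range_mult bounded_range_compose[OF bounded_qpoch, of q _ "\<lambda>k. k r"]
          bounded_range_compose[OF bounded_inverse_qpoch, of q _ "\<lambda>k. k r"]) (auto simp: qpoch_def)
    ultimately show ?thesis by simp
  qed
  then have "bounded (range (\<lambda>k. \<Prod>r\<in>I. \<Prod>s\<in>I. \<Prod>t<k r. (x s - a s * x r * q ^ t) / (x s - x r * q ^ Suc t)))"
    by (intro bounded_range_prod) auto
  from bounded_range_mult[OF 1 this] show ?thesis by (simp add: milne_weight_def)
qed

text \<open>At most geometric growth in \<open>d\<close> is enough, because a factor
  \<open>q ^ (d choose 2)\<close> always accompanies \<open>lowered_product\<close>.\<close>

lemma norm_lowered_product_le:
  assumes q: "norm q < 1" and fin: "finite I" and x1: "\<And>i t. i \<in> I \<Longrightarrow> x i * q ^ t \<noteq> 1"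
  obtains M Y :: real where "M > 0" "Y \<ge> 0" "\<And>d. norm (lowered_product I q a x d) \<le> M * Y ^ d"
proof -
  have "bounded (range (\<lambda>d. \<Prod>s\<in>I. inverse (qpoch q (x s) d)))"
    using q x1 by (intro bounded_range_prod bounded_inverse_qpoch) (auto simp: qpoch_def)
  then obtain M where M: "M > 0" "\<And>d. norm (\<Prod>s\<in>I. inverse (qpoch q (x s) d)) \<le> M"
    by (auto simp: bounded_pos)
  define Y where "Y = (\<Prod>s\<in>I. norm (a s) + norm (x s))"
  have "norm (lowered_product I q a x d) \<le> M * Y ^ d" for d
  proof -
    have *: "norm (a s - x s * q ^ t) \<le> norm (a s) + norm (x s)" for s t
    proof -
      have "norm (x s * q ^ t) \<le> norm (x s)"
        using q by (simp add: norm_mult norm_power mult_left_le power_le_one)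
      then show ?thesis using norm_triangle_ineq4[of "a s" "x s * q ^ t"] by linarith
    qed
    have "(\<Prod>s\<in>I. \<Prod>t<d. norm (a s - x s * q ^ t)) \<le> (\<Prod>s\<in>I. \<Prod>t<d. norm (a s) + norm (x s))"
      using * by (intro prod_mono conjI prod_nonneg) auto
    then have 1: "norm (\<Prod>s\<in>I. \<Prod>t<d. a s - x s * q ^ t) \<le> Y ^ d"
      by (simp add: Y_def prod_norm[symmetric] prod_power_distrib)
    have "lowered_product I q a x d = (\<Prod>s\<in>I. inverse (qpoch q (x s) d)) * (\<Prod>s\<in>I. \<Prod>t<d. a s - x s * q ^ t)"
      by (simp add: lowered_product_def prod_dividef qpoch_def divide_inverse prod.distrib mult_ac flip: prod_inversef)
    then show ?thesis
      unfolding norm_mult using M 1 by (simp only: norm_mult) (intro mult_mono, auto)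
  qed
  moreover have "Y \<ge> 0" by (auto simp: Y_def intro!: prod_nonneg)
  ultimately show thesis using that M(1) by blast
qed

section \<open>Expressing both series through \<open>milne_term\<close> and
  \<open>milne_coeff\<close>\<close>

section \<open>The terms of the two series\<close>

lemma prod_power_gaussian: "(\<Prod>t<k. (q::complex) ^ t) = q ^ (k choose 2)"
  by (induction k) (simp_all add: numeral_2_eq_2 power_add mult_ac)

lemma choose_two_add: "(d + m) choose 2 = (d choose 2) + (m choose 2) + d * m"
  by (induction m) (simp_all add: numeral_2_eq_2)

lemma qpoch_add: "qpoch q z (d + m) = qpoch q z d * qpoch q (z * q ^ d) m"
  by (induction m) (simp_all add: qpoch_Suc qpoch_def[of _ _ 0] power_add mult_ac)

lemma prod_reversed_qpoch:
  "(\<Prod>t<m. A * z * q ^ (d + m) - A * q ^ t) = (- A) ^ m * q ^ (m choose 2) * qpoch q (z * q ^ Suc d) m"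
proof -
  have "(\<Prod>t<m. A * z * q ^ (d + m) - A * q ^ t) = (\<Prod>t<m. (- A) * q ^ t * (1 - z * q ^ Suc d * q ^ (m - Suc t)))"
  proof (rule prod.cong)
    fix t assume "t \<in> {..<m}"
    then have "t + (Suc d + (m - Suc t)) = d + m" by simp
    then have "q ^ (d + m) = q ^ t * (q ^ Suc d * q ^ (m - Suc t))" by (metis power_add)
    then show "A * z * q ^ (d + m) - A * q ^ t = (- A) * q ^ t * (1 - z * q ^ Suc d * q ^ (m - Suc t))"
      by (simp only:) (simp add: algebra_simps)
  qed simp
  also have "\<dots> = (- A) ^ m * q ^ (m choose 2) * (\<Prod>t<m. 1 - z * q ^ Suc d * q ^ (m - Suc t))"
    by (simp only: prod.distrib prod_power_gaussian prod_constant card_lessThan)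
  also have "(\<Prod>t<m. 1 - z * q ^ Suc d * q ^ (m - Suc t)) = qpoch q (z * q ^ Suc d) m"
    unfolding qpoch_def by (rule prod.nat_diff_reindex)
  finally show ?thesis .
qed

text \<open>Read in reverse order, each factor times \<open>X * q ^ t\<close> becomes
  \<open>X * q ^ t - c * q ^ K\<close>, because the exponents add up to \<open>K\<close>. This gives
  the right series its numerators, with \<open>D = c * q ^ K\<close> and
  \<open>E = 1\<close>.\<close>

lemma qpoch_reversed:
  assumes "X \<noteq> 0" and "k \<le> K"
  shows "qpoch q (c * q ^ (1 + K - k) / X) k * X ^ k * q ^ (k choose 2) =
     (- 1) ^ k * (\<Prod>t<k. c * q ^ K - X * q ^ t)"
proof -
  have "qpoch q (c * q ^ (1 + K - k) / X) k = (\<Prod>t<k. 1 - c * q ^ (1 + K - k) / X * q ^ (k - Suc t))"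
    unfolding qpoch_def by (rule prod.nat_diff_reindex[symmetric])
  also have "\<dots> * X ^ k * q ^ (k choose 2) = (\<Prod>t<k. (1 - c * q ^ (1 + K - k) / X * q ^ (k - Suc t)) * X * q ^ t)"
    by (simp only: prod.distrib prod_power_gaussian prod_constant card_lessThan)
  also have "\<dots> = (\<Prod>t<k. (- 1) * (c * q ^ K - X * q ^ t))"
  proof (rule prod.cong)
    fix t assume "t \<in> {..<k}"
    then have "(1 + K - k) + (k - Suc t) + t = K" using assms(2) by simp
    then have "q ^ K = q ^ (1 + K - k) * q ^ (k - Suc t) * q ^ t" by (metis power_add)
    then show "(1 - c * q ^ (1 + K - k) / X * q ^ (k - Suc t)) * X * q ^ t = (- 1) * (c * q ^ K - X * q ^ t)"
      using assms(1) by (simp only:) (simp add: field_simps)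
  qed simp
  also have "\<dots> = (- 1) ^ k * (\<Prod>t<k. c * q ^ K - X * q ^ t)"
    by (simp only: prod.distrib prod_constant card_lessThan)
  finally show ?thesis .
qed

lemma prod_triangle:
  fixes f :: "nat \<Rightarrow> nat \<Rightarrow> complex"
  shows "(\<Prod>r=1..n. \<Prod>s\<in>{r<..n}. f r s) = (\<Prod>(r, s)\<in>pairs {1..n}. f r s)"
proof -
  have "pairs {1..n} = (SIGMA r:{1..n}. {r<..n})" by (auto simp: pairs_def)
  then show ?thesis by (simp add: prod.Sigma)
qed

lemma sum_triangle: "(\<Sum>r=1..n. \<Sum>s\<in>{r<..n}. k s) = (\<Sum>s=1..n. (s - 1) * k s)"
  for k :: "nat \<Rightarrow> nat"
proof (induction n)
  case (Suc n)
  have "(\<Sum>r=1..n. \<Sum>s\<in>{r<..Suc n}. k s) = (\<Sum>r=1..n. (\<Sum>s\<in>{r<..n}. k s) + k (Suc n))"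
  proof (rule sum.cong)
    fix r assume "r \<in> {1..n}"
    then have "{r<..Suc n} = insert (Suc n) {r<..n}" by auto
    then show "(\<Sum>s\<in>{r<..Suc n}. k s) = (\<Sum>s\<in>{r<..n}. k s) + k (Suc n)" by simp
  qed simp
  then show ?case using Suc by (simp add: sum.distrib)
qed simp

lemma milne_weight_interval:
  assumes q: "q \<noteq> 0" and nr: "nonresonant {1..n} q x"
  shows "(\<Prod>r=1..n. \<Prod>s\<in>{r<..n}.
        (1 - q powi (int (k r) - int (k s)) * (x r / x s)) / (1 - x r / x s)) *
     (\<Prod>r=1..n. \<Prod>s=1..n. qpoch q (a * x r / x s) (k r) / qpoch q (q * x r / x s) (k r)) *
     q ^ (\<Sum>r=1..n. (r - 1) * k r) = milne_weight {1..n} q (\<lambda>_. a) x k"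
proof -
  have x0: "x r \<noteq> 0" if "r \<in> {1..n}" for r using nr that by (auto simp: nonresonant_def)
  have 1: "(\<Prod>r=1..n. \<Prod>s\<in>{r<..n}.
        (1 - q powi (int (k r) - int (k s)) * (x r / x s)) / (1 - x r / x s)) *
      q ^ (\<Sum>r=1..n. (r - 1) * k r) =
      (\<Prod>(r, s)\<in>pairs {1..n}. (x s * q ^ k s - x r * q ^ k r) / (x s - x r))"
  proof -
    \<comment> \<open>Each index \<open>s\<close> is the larger one in \<open>s - 1\<close> pairs,
      so the power of \<open>q\<close> splits into one \<open>q ^ k s\<close> per pair, which clears
      the negative exponent there.\<close>
    have "q ^ (\<Sum>r=1..n. (r - 1) * k r) = (\<Prod>r=1..n. \<Prod>s\<in>{r<..n}. q ^ k s)"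
      unfolding sum_triangle[symmetric] by (simp add: power_sum)
    then have "(\<Prod>r=1..n. \<Prod>s\<in>{r<..n}.
        (1 - q powi (int (k r) - int (k s)) * (x r / x s)) / (1 - x r / x s)) *
      q ^ (\<Sum>r=1..n. (r - 1) * k r) = (\<Prod>r=1..n. \<Prod>s\<in>{r<..n}.
        (1 - q powi (int (k r) - int (k s)) * (x r / x s)) / (1 - x r / x s) * q ^ k s)"
      by (simp only: prod.distrib)
    also have "\<dots> = (\<Prod>r=1..n. \<Prod>s\<in>{r<..n}. (x s * q ^ k s - x r * q ^ k r) / (x s - x r))"
    proof (intro prod.cong refl)
      fix r s assume "r \<in> {1..n}" "s \<in> {r<..n}"
      then have s: "x s \<noteq> 0" using x0[of s] by auto
      have pw: "q powi (int (k r) - int (k s)) = q ^ k r / q ^ k s"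
        using q by (simp add: power_int_diff)
      have A: "(1 - q powi (int (k r) - int (k s)) * (x r / x s)) * q ^ k s = (x s * q ^ k s - x r * q ^ k r) / x s"
        using q s unfolding pw by (simp add: field_simps)
      have B: "1 - x r / x s = (x s - x r) / x s" using s by (simp add: field_simps)
      show "(1 - q powi (int (k r) - int (k s)) * (x r / x s)) / (1 - x r / x s) * q ^ k s =
        (x s * q ^ k s - x r * q ^ k r) / (x s - x r)"
        unfolding times_divide_eq_left A B using s by simp
    qed
    finally show ?thesis unfolding prod_triangle .
  qed
  have 2: "(\<Prod>r=1..n. \<Prod>s=1..n. qpoch q (a * x r / x s) (k r) / qpoch q (q * x r / x s) (k r)) =
     (\<Prod>r\<in>{1..n}. \<Prod>s\<in>{1..n}. \<Prod>t<k r. (x s - a * x r * q ^ t) / (x s - x r * q ^ Suc t))"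
  proof (intro prod.cong refl)
    fix r s assume "r \<in> {1..n}" "s \<in> {1..n}"
    then have s: "x s \<noteq> 0" using x0 by auto
    have "(1 - a * x r / x s * q ^ t) / (1 - q * x r / x s * q ^ t) =
        (x s - a * x r * q ^ t) / (x s - x r * q ^ Suc t)" for t
    proof -
      have "x s - a * x r * q ^ t = x s * (1 - a * x r / x s * q ^ t)"
        "x s - x r * q ^ Suc t = x s * (1 - q * x r / x s * q ^ t)"
        using s by (simp_all add: field_simps)
      then show ?thesis using s by simp
    qed
    then show "qpoch q (a * x r / x s) (k r) / qpoch q (q * x r / x s) (k r) =
      (\<Prod>t<k r. (x s - a * x r * q ^ t) / (x s - x r * q ^ Suc t))"
      by (simp only: qpoch_def prod_dividef[symmetric])
  qed
  show ?thesis unfolding milne_weight_def 1[symmetric] 2[symmetric] by (simp only: mult_ac)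
qed

lemma multi_indices_weight: "{k \<in> multi_indices n. mweight n k = N} = compositions {1..n} N"
  by (simp add: multi_indices_def compositions_def mweight_def)

lemma lhs_term_eq:
  assumes q: "q \<noteq> 0" and b: "b \<noteq> 0" and nr: "nonresonant {1..n} q x"
  shows "lhs_term n q a b z x j = qpoch q q (mweight n j) * (z / a ^ (n - 1)) ^ mweight n j *
     milne_term {1..n} q (\<lambda>_. a) (\<lambda>i. b * x i) 1 0 j"
proof -
  have "(\<Prod>i=1..n. \<Prod>t<j i. (1 - 0 * (b * x i) * q ^ t) / (1 - b * x i * q ^ t)) =
     1 / (\<Prod>i=1..n. qpoch q (b * x i) (j i))"
    by (simp add: qpoch_def prod_dividef)
  then show ?thesis
    unfolding lhs_term_def milne_term_def milne_weight_scale[OF b]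
      milne_weight_interval[OF q nr, symmetric] by simp
qed

lemma rhs_term_eq:
  assumes q: "q \<noteq> 0" and b: "b \<noteq> 0" and nr: "nonresonant {1..n} q x"
  shows "rhs_term n q a b z x k =
     (1 - a * z * q ^ (2 * mweight n k)) * qpoch q q (mweight n k) /
        qpoch q (z / a ^ (n - 1)) (Suc (mweight n k)) *
     (- (z / a ^ (n - 1))) ^ mweight n k * q ^ (mweight n k choose 2) *
     milne_term {1..n} q (\<lambda>_. a) (\<lambda>i. b * x i) (a * z * q ^ mweight n k) 1 k"
proof -
  let ?K = "mweight n k"
  define F where "F i = qpoch q (a * z * q ^ (1 + ?K - k i) / (b * x i)) (k i)" for i
  \<comment> \<open>These powers are exactly what \<open>qpoch_reversed\<close> needs for each
    \<open>i\<close>. Its signs multiply to \<open>(-1) ^ ?K\<close> and turn the base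
    \<open>z / a ^ (n - 1)\<close> into its negative.\<close>
  have "(\<Prod>i=1..n. F i) * b ^ ?K * q ^ (\<Sum>i=1..n. k i choose 2) * (\<Prod>i=1..n. x i ^ k i)
     = (\<Prod>i=1..n. F i * (b * x i) ^ k i * q ^ (k i choose 2))"
    by (simp add: prod.distrib power_mult_distrib power_sum mweight_def mult_ac)
  also have "\<dots> = (\<Prod>i=1..n. (- 1) ^ k i * (\<Prod>t<k i. a * z * q ^ ?K - b * x i * q ^ t))"
  proof (rule prod.cong)
    fix i assume i: "i \<in> {1..n}"
    then have "k i \<le> ?K" unfolding mweight_def by (intro member_le_sum) auto
    moreover have "b * x i \<noteq> 0" using b nr i by (auto simp: nonresonant_def)
    ultimately show "F i * (b * x i) ^ k i * q ^ (k i choose 2) =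
        (- 1) ^ k i * (\<Prod>t<k i. a * z * q ^ ?K - b * x i * q ^ t)"
      unfolding F_def by (rule qpoch_reversed[rotated])
  qed simp
  also have "\<dots> = (- 1) ^ ?K * (\<Prod>i=1..n. \<Prod>t<k i. a * z * q ^ ?K - b * x i * q ^ t)"
    by (simp add: prod.distrib power_sum mweight_def)
  finally have *: "(\<Prod>i=1..n. F i) * b ^ ?K * q ^ (\<Sum>i=1..n. k i choose 2) * (\<Prod>i=1..n. x i ^ k i)
      = (- 1) ^ ?K * (\<Prod>i=1..n. \<Prod>t<k i. a * z * q ^ ?K - b * x i * q ^ t)" .
  define V where "V = (\<Prod>r=1..n. \<Prod>s\<in>{r<..n}.
        (1 - q powi (int (k r) - int (k s)) * (x r / x s)) / (1 - x r / x s))"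
  define U where "U = (\<Prod>r=1..n. \<Prod>s=1..n. qpoch q (a * x r / x s) (k r) / qpoch q (q * x r / x s) (k r))"
  define G where "G = (\<Prod>i=1..n. qpoch q (b * x i) (k i))"
  define P where "P = (1 - a * z * q ^ (2 * ?K)) * qpoch q q ?K / qpoch q (z / a ^ (n - 1)) (Suc ?K)"
  have "rhs_term n q a b z x k = (V * U * q ^ (\<Sum>r=1..n. (r - 1) * k r)) * P * (z / a ^ (n - 1)) ^ ?K *
      q ^ (?K choose 2) * ((\<Prod>i=1..n. F i) * b ^ ?K * q ^ (\<Sum>i=1..n. k i choose 2) * (\<Prod>i=1..n. x i ^ k i)) / G"
    unfolding rhs_term_def V_def[symmetric] U_def[symmetric] F_def[symmetric] Suc_eq_plus1[symmetric] P_def[symmetric]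
    unfolding prod_dividef G_def[symmetric] power_add
    by (simp add: power_divide power_mult_distrib mult_ac)
  also have "\<dots> = P * (- (z / a ^ (n - 1))) ^ ?K * q ^ (?K choose 2) *
     milne_term {1..n} q (\<lambda>_. a) (\<lambda>i. b * x i) (a * z * q ^ ?K) 1 k"
    unfolding * unfolding V_def U_def milne_weight_interval[OF q nr] milne_term_def milne_weight_scale[OF b]
    by (simp add: power_minus[of "z / _"] G_def qpoch_def prod_dividef)
  finally show ?thesis unfolding P_def .
qed

text \<open>For \<open>D = 1\<close>, \<open>E = 0\<close> the first product of
  \<open>milne_coeff\<close> is 1 and the second is the product of the
  \<open>- (q ^ t)\<close>.\<close>

lemma lhs_coeff:
  "qpoch q q (d + m) * w ^ (d + m) * milne_coeff q A 1 0 (d + m) d =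
     (- w) ^ d * q ^ (d choose 2) * (qbinom q d m * w ^ m)"
proof -
  have "(\<Prod>t<d. 0 - 1 * q ^ t) = (\<Prod>t<d. (- 1) * q ^ t)" by simp
  also have "\<dots> = (- 1) ^ d * q ^ (d choose 2)"
    by (simp only: prod.distrib prod_power_gaussian prod_constant card_lessThan)
  finally have "(\<Prod>t<d. 0 - 1 * q ^ t) = (- 1) ^ d * q ^ (d choose 2)" .
  then show ?thesis
    unfolding milne_coeff_def qbinom_def
    by (simp add: power_add power_minus[of w] mult_ac)
qed

text \<open>For \<open>D = A * w * q ^ N\<close> the first product of \<open>milne_coeff\<close>,
  reversed, contains \<open>R\<close>, the tail of \<open>qpoch q w (Suc N)\<close> after its first
  \<open>Suc d\<close> factors. Cancelling it leaves a denominator that depends on \<open>d\<close>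
  only.\<close>

lemma rhs_coeff:
  assumes w: "\<And>k. qpoch q w (Suc k) \<noteq> 0"
  shows "(1 - A * w * q ^ (2 * (d + m))) * qpoch q q (d + m) / qpoch q w (Suc (d + m)) *
      (- w) ^ (d + m) * q ^ ((d + m) choose 2) * milne_coeff q A (A * w * q ^ (d + m)) 1 (d + m) d =
     (- w) ^ d * q ^ (d choose 2) / qpoch q w (Suc d) * unit_term q (A * w) d m"
proof -
  define R where "R = qpoch q (w * q ^ Suc d) m"
  have split: "qpoch q w (Suc (d + m)) = qpoch q w (Suc d) * R"
    using qpoch_add[of q w "Suc d" m] by (simp add: R_def)
  then have R: "R \<noteq> 0" using w[of "d + m"] by auto
  have 1: "(\<Prod>t<d + m - d. A * w * q ^ (d + m) - A * 1 * q ^ t) = (- A) ^ m * q ^ (m choose 2) * R"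
    unfolding R_def using prod_reversed_qpoch[of A w q d m] by simp
  have 2: "(\<Prod>t<d. 1 - A * w * q ^ (d + m) * q ^ t) = qpoch q (A * w * q ^ (d + m)) d"
    by (simp add: qpoch_def)
  have 3: "q ^ ((d + m) choose 2) = q ^ (d choose 2) * q ^ (m choose 2) * q ^ (d * m)"
    by (simp add: choose_two_add power_add)
  have 4: "q ^ (d * m + 2 * (m choose 2)) = q ^ (m choose 2) * q ^ (m choose 2) * q ^ (d * m)"
    by (simp add: power_add mult_2)
  have 5: "(- w) ^ (d + m) * (- A) ^ m = (- w) ^ d * (A * w) ^ m"
    by (simp add: power_add mult.assoc flip: power_mult_distrib) (simp add: mult.commute)
  define X where "X = (1 - A * w * q ^ (2 * (d + m))) * qpoch q (A * w * q ^ (d + m)) d *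
     (q ^ (d choose 2) * q ^ (m choose 2) * q ^ (d * m) * q ^ (m choose 2))"
  have "(1 - A * w * q ^ (2 * (d + m))) * qpoch q q (d + m) / qpoch q w (Suc (d + m)) *
      (- w) ^ (d + m) * q ^ ((d + m) choose 2) * milne_coeff q A (A * w * q ^ (d + m)) 1 (d + m) d =
      ((- w) ^ (d + m) * (- A) ^ m) * qbinom q d m * X / qpoch q w (Suc d)"
    unfolding milne_coeff_def 1 2 3 split qbinom_def X_def using R by (simp add: mult_ac)
  also have "\<dots> = (- w) ^ d * q ^ (d choose 2) / qpoch q w (Suc d) * unit_term q (A * w) d m"
    unfolding 5 unit_term_def 4 X_def by (simp add: mult_ac)
  finally show ?thesis .
qed

section \<open>Absolute convergence of both series\<close>

lemma norm_milne_term_le: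
  assumes q: "norm q < 1" and fin: "finite I" and nr: "nonresonant I q x"
    and x1: "\<And>i t. i \<in> I \<Longrightarrow> x i * q ^ t \<noteq> 1"
  obtains M where "M > 0" "\<And>D E \<delta> k. norm D \<le> \<delta> \<Longrightarrow> norm (milne_term I q a x D E k) \<le>
     M * (\<delta> + norm E * (\<Sum>i\<in>I. norm (x i))) ^ (\<Sum>i\<in>I. k i)"
proof -
  have "bounded (range (\<lambda>k. milne_weight I q a x k * (\<Prod>i\<in>I. inverse (qpoch q (x i) (k i)))))"
  proof (intro bounded_range_mult bounded_milne_weight bounded_range_prod)
    fix i assume i: "i \<in> I"
    show "bounded (range (\<lambda>k. inverse (qpoch q (x i) (k i))))"
      using q x1[OF i] by (intro bounded_range_compose[OF bounded_inverse_qpoch, of q _ "\<lambda>k. k i"])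
        (auto simp: qpoch_def)
  qed (use assms in auto)
  \<comment> \<open>\<open>M\<close> is chosen before \<open>D\<close> and \<open>E\<close>: on the
    right \<open>D = a z q ^ mweight n k\<close> varies with the multi-index, so the bound has to be
    uniform in it.\<close>
  then obtain M where M: "M > 0"
    "\<And>k. norm (milne_weight I q a x k * (\<Prod>i\<in>I. inverse (qpoch q (x i) (k i)))) \<le> M"
    by (auto simp: bounded_pos)
  define s where "s = (\<Sum>i\<in>I. norm (x i))"
  have "norm (milne_term I q a x D E k) \<le> M * (\<delta> + norm E * s) ^ (\<Sum>i\<in>I. k i)"
    if D: "norm D \<le> \<delta>" for D E \<delta> k
  proof -
    have le: "norm (D - E * x i * q ^ t) \<le> \<delta> + norm E * s" if i: "i \<in> I" for i t
    proof -
      have "norm (x i * q ^ t) \<le> norm (x i)"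
        using q by (simp add: norm_mult norm_power mult_left_le power_le_one)
      also have "\<dots> \<le> s" unfolding s_def using fin i by (intro member_le_sum) auto
      finally have "norm E * norm (x i * q ^ t) \<le> norm E * s" by (intro mult_left_mono) auto
      then show ?thesis
        using D norm_triangle_ineq4[of D "E * x i * q ^ t"] by (simp add: norm_mult mult.assoc)
    qed
    have "norm (\<Prod>i\<in>I. \<Prod>t<k i. D - E * x i * q ^ t) \<le> (\<Prod>i\<in>I. \<Prod>t<k i. \<delta> + norm E * s)"
      unfolding prod_norm[symmetric] using le by (intro prod_mono conjI prod_nonneg) auto
    also have "\<dots> = (\<delta> + norm E * s) ^ (\<Sum>i\<in>I. k i)" by (simp add: power_sum)
    finally have 1: "norm (\<Prod>i\<in>I. \<Prod>t<k i. D - E * x i * q ^ t) \<le> (\<delta> + norm E * s) ^ (\<Sum>i\<in>I. k i)" .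
    have "milne_term I q a x D E k = (milne_weight I q a x k * (\<Prod>i\<in>I. inverse (qpoch q (x i) (k i)))) *
       (\<Prod>i\<in>I. \<Prod>t<k i. D - E * x i * q ^ t)"
      by (simp add: milne_term_def prod_dividef qpoch_def divide_inverse mult_ac prod.distrib flip: prod_inversef)
    then show ?thesis using M 1 by (simp only: norm_mult) (intro mult_mono, auto)
  qed
  then show thesis using that M(1) unfolding s_def by blast
qed

lemma lhs_term_summable:
  assumes q0: "q \<noteq> 0" and q: "norm q < 1" and b: "b \<noteq> 0" and nr: "nonresonant {1..n} q x"
    and z: "norm (z / a ^ (n - 1)) < 1"
    and x1: "\<And>i t. i \<in> {1..n} \<Longrightarrow> b * x i * q ^ t \<noteq> 1"
    and nr': "nonresonant {1..n} q (\<lambda>i. b * x i)"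
  shows "lhs_term n q a b z x summable_on multi_indices n"
proof -
  let ?w = "z / a ^ (n - 1)"
  obtain M where M: "M > 0" "\<And>D E \<delta> k. norm D \<le> \<delta> \<Longrightarrow> norm (milne_term {1..n} q (\<lambda>_. a) (\<lambda>i. b * x i) D E k) \<le>
     M * (\<delta> + norm E * (\<Sum>i\<in>{1..n}. norm (b * x i))) ^ (\<Sum>i\<in>{1..n}. k i)"
    using norm_milne_term_le[OF q _ nr' x1, of "\<lambda>_. a"] by (metis finite_atLeastAtMost)
  obtain B where B: "B > 0" "\<And>k. norm (qpoch q q k) \<le> B"
    using bounded_qpoch[OF q] by (auto simp: bounded_pos)
  show ?thesis
  proof (rule summable_on_norm_comparison)
    show "(\<lambda>k. B * M * norm ?w ^ (\<Sum>i\<in>{1..n}. k i)) summable_on multi_indices n"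
      unfolding multi_indices_def using z
      by (intro summable_on_cmult_right summable_on_power_PiE) auto
    fix k
    have "norm (lhs_term n q a b z x k) = norm (qpoch q q (mweight n k)) * norm ?w ^ mweight n k *
       norm (milne_term {1..n} q (\<lambda>_. a) (\<lambda>i. b * x i) 1 0 k)"
      unfolding lhs_term_eq[OF q0 b nr] by (simp add: norm_mult norm_power)
    also have "\<dots> \<le> B * norm ?w ^ mweight n k * M"
      using B M(1) M(2)[of 1 1 0 k] by (intro mult_mono) auto
    finally show "norm (lhs_term n q a b z x k) \<le> B * M * norm ?w ^ (\<Sum>i\<in>{1..n}. k i)"
      by (simp add: mweight_def mult_ac)
  qed
qed

lemma gaussian_dominated:
  fixes L r :: real
  assumes "0 \<le> L" "0 \<le> r" "r < 1"
  obtains K where "K > 0" "\<And>N. L ^ N * r ^ (N choose 2) \<le> K * (1 / 2) ^ N"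
proof -
  \<comment> \<open>The additional \<open>2 ^ N\<close> is what leaves \<open>(1 / 2) ^ N\<close>
    after division.\<close>
  have "bounded (range (\<lambda>N. (2 * L) ^ N * r ^ (N choose 2)))"
    using assms by (intro convergent_imp_bounded[OF summable_LIMSEQ_zero] summable_power_gaussian) auto
  then obtain K where K: "K > 0" "\<And>N. norm ((2 * L) ^ N * r ^ (N choose 2)) \<le> K"
    by (auto simp: bounded_pos)
  have "L ^ N * r ^ (N choose 2) \<le> K * (1 / 2) ^ N" for N
    using K(2)[of N] assms by (simp add: power_mult_distrib power_one_over field_simps)
  then show thesis using that K(1) by blast
qed

text \<open>The factor \<open>q ^ (mweight n k choose 2)\<close> beats the geometric growth of the
  rest, so the terms are dominated by a geometric series over multi-indices with ratio
  \<open>1 / 2\<close>.\<close>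

lemma rhs_term_summable:
  assumes q0: "q \<noteq> 0" and q: "norm q < 1" and b: "b \<noteq> 0" and nr: "nonresonant {1..n} q x"
    and w: "\<And>k. qpoch q (z / a ^ (n - 1)) k \<noteq> 0"
    and x1: "\<And>i t. i \<in> {1..n} \<Longrightarrow> b * x i * q ^ t \<noteq> 1"
    and nr': "nonresonant {1..n} q (\<lambda>i. b * x i)"
  shows "rhs_term n q a b z x summable_on multi_indices n"
proof -
  let ?w = "z / a ^ (n - 1)"
  define Y where "Y = norm (a * z) + norm (1::complex) * (\<Sum>i\<in>{1..n}. norm (b * x i))"
  have Y: "Y \<ge> 0" unfolding Y_def by (intro add_nonneg_nonneg mult_nonneg_nonneg sum_nonneg) auto
  obtain M where M: "M > 0" "\<And>D E \<delta> k. norm D \<le> \<delta> \<Longrightarrow> norm (milne_term {1..n} q (\<lambda>_. a) (\<lambda>i. b * x i) D E k) \<le>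
     M * (\<delta> + norm E * (\<Sum>i\<in>{1..n}. norm (b * x i))) ^ (\<Sum>i\<in>{1..n}. k i)"
    using norm_milne_term_le[OF q _ nr' x1, of "\<lambda>_. a"] by (metis finite_atLeastAtMost)
  obtain B where B: "B > 0" "\<And>k. norm (qpoch q q k) \<le> B"
    using bounded_qpoch[OF q] by (auto simp: bounded_pos)
  obtain B' where B': "B' > 0" "\<And>k. norm (inverse (qpoch q ?w k)) \<le> B'"
    using bounded_inverse_qpoch[OF q w] by (auto simp: bounded_pos)
  obtain K where K: "K > 0" "\<And>N. (norm ?w * Y) ^ N * norm q ^ (N choose 2) \<le> K * (1 / 2) ^ N"
    using gaussian_dominated[of "norm ?w * Y" "norm q"] q Y by (metis mult_nonneg_nonneg norm_ge_zero)
  define S where "S = (1 + norm (a * z)) * B * B' * M"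
  have S: "S \<ge> 0" using B B' M by (auto simp: S_def)
  show ?thesis
  proof (rule summable_on_norm_comparison)
    show "(\<lambda>k. S * K * (1 / 2) ^ (\<Sum>i\<in>{1..n}. k i)) summable_on multi_indices n"
      unfolding multi_indices_def
      by (intro summable_on_cmult_right summable_on_power_PiE) auto
    fix k
    let ?N = "mweight n k"
    have qz: "norm (a * z * q ^ j) \<le> norm (a * z)" for j
      using q by (simp add: norm_mult norm_power mult_left_le power_le_one)
    have 1: "norm (1 - a * z * q ^ (2 * ?N)) \<le> 1 + norm (a * z)"
      using norm_triangle_ineq4[of 1 "a * z * q ^ (2 * ?N)"] qz[of "2 * ?N"] by simp
    have 2: "norm (milne_term {1..n} q (\<lambda>_. a) (\<lambda>i. b * x i) (a * z * q ^ ?N) 1 k) \<le> M * Y ^ ?N"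
      using M(2)[OF qz] unfolding Y_def mweight_def .
    have "norm (rhs_term n q a b z x k) = norm (1 - a * z * q ^ (2 * ?N)) * norm (qpoch q q ?N) *
       norm (inverse (qpoch q ?w (Suc ?N))) *
       norm ?w ^ ?N * norm q ^ (?N choose 2) *
       norm (milne_term {1..n} q (\<lambda>_. a) (\<lambda>i. b * x i) (a * z * q ^ ?N) 1 k)"
      unfolding rhs_term_eq[OF q0 b nr]
      by (simp only: norm_mult norm_power norm_minus_cancel divide_inverse)
    also have "\<dots> \<le> (1 + norm (a * z)) * B * B' * norm ?w ^ ?N * norm q ^ (?N choose 2) * (M * Y ^ ?N)"
      using B B' 1 2 by (intro mult_mono) auto
    also have "\<dots> = S * ((norm ?w * Y) ^ ?N * norm q ^ (?N choose 2))"
      by (simp add: S_def power_mult_distrib mult_ac)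
    also have "\<dots> \<le> S * (K * (1 / 2) ^ ?N)"
      using K S by (intro mult_left_mono) auto
    finally show "norm (rhs_term n q a b z x k) \<le> S * K * (1 / 2) ^ (\<Sum>i\<in>{1..n}. k i)"
      by (simp add: mweight_def mult_ac)
  qed
qed

lemma infsum_multi_indices:
  fixes f :: "(nat \<Rightarrow> nat) \<Rightarrow> complex"
  assumes "f summable_on multi_indices n"
    and "\<And>N. (\<Sum>k\<in>compositions {1..n} N. f k) = (\<Sum>d\<le>N. g (d, N - d))"
    and "g summable_on UNIV" and "\<And>d. (\<lambda>m. g (d, m)) sums T d"
  shows "infsum f (multi_indices n) = (\<Sum>\<^sub>\<infinity>d. T d)"
proof -
  have "infsum f (multi_indices n) = (\<Sum>\<^sub>\<infinity>N. \<Sum>k\<in>compositions {1..n} N. f k)"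
    unfolding infsum_fibres[OF assms(1), of "mweight n"] multi_indices_weight
    by (simp add: finite_compositions)
  then show ?thesis unfolding assms(2) infsum_antidiagonals[OF assms(3,4)] .
qed

text \<open>The bound is uniform in \<open>d\<close>, as required for a majorant of product form in
  \<open>summable_on_product_bound\<close>.\<close>

lemma norm_unit_term_le:
  assumes q: "norm q < 1"
  obtains K where "K > 0" "\<And>d m. norm (unit_term q C d m) \<le> K * (norm C ^ m * norm q ^ (m choose 2))"
proof -
  obtain B where B: "B > 0" "\<And>d m. norm (qbinom q d m) \<le> B" using bounded_qbinom[OF q] by metis
  define E where "E = exp (norm C / (1 - norm q))"
  have Cq: "norm (C * q ^ j) \<le> norm C" for j
    using q by (simp add: norm_mult norm_power mult_left_le power_le_one)
  have "norm (unit_term q C d m) \<le> (1 + norm C) * B * E * (norm C ^ m * norm q ^ (m choose 2))" for d m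
  proof -
    have 1: "norm (1 - C * q ^ (2 * (d + m))) \<le> 1 + norm C"
      using norm_triangle_ineq4[of 1 "C * q ^ (2 * (d + m))"] Cq[of "2 * (d + m)"] by simp
    have 2: "norm (qpoch q (C * q ^ (d + m)) d) \<le> E"
      unfolding E_def by (rule norm_qpoch_le[OF q Cq])
    have 3: "norm (q ^ (d * m + 2 * (m choose 2))) \<le> norm q ^ (m choose 2)"
      using q unfolding norm_power by (intro power_decreasing) auto
    have "norm (unit_term q C d m) = norm (1 - C * q ^ (2 * (d + m))) * norm (qbinom q d m) *
        norm (qpoch q (C * q ^ (d + m)) d) * norm C ^ m * norm (q ^ (d * m + 2 * (m choose 2)))"
      by (simp only: unit_term_def norm_mult norm_power)
    also have "\<dots> \<le> (1 + norm C) * B * E * norm C ^ m * norm q ^ (m choose 2)"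
      using 1 2 3 B by (intro mult_mono) (auto simp: E_def)
    finally show ?thesis by (simp add: mult_ac)
  qed
  moreover have "(1 + norm C) * B * E > 0"
    using B by (auto simp: E_def intro!: mult_pos_pos add_pos_nonneg)
  ultimately show thesis using that by blast
qed

lemma summable_leading_factor:
  assumes q: "norm q < 1" and fin: "finite I" and x1: "\<And>i t. i \<in> I \<Longrightarrow> x i * q ^ t \<noteq> 1"
  shows "summable (\<lambda>d. norm ((- w) ^ d * q ^ (d choose 2) * lowered_product I q a x d))"
proof -
  obtain M Y :: real where MY: "M > 0" "Y \<ge> 0" "\<And>d. norm (lowered_product I q a x d) \<le> M * Y ^ d"
    by (rule norm_lowered_product_le[OF q fin x1, where a = a]) (assumption, rule that)
  show ?thesis
  proof (rule summable_comparison_test')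
    show "summable (\<lambda>d. M * ((norm w * Y) ^ d * norm q ^ (d choose 2)))"
      using MY q by (intro summable_mult summable_power_gaussian) auto
    fix d
    have "norm ((- w) ^ d * q ^ (d choose 2) * lowered_product I q a x d) =
        norm w ^ d * norm q ^ (d choose 2) * norm (lowered_product I q a x d)"
      by (simp only: norm_mult norm_power norm_minus_cancel)
    also have "\<dots> \<le> norm w ^ d * norm q ^ (d choose 2) * (M * Y ^ d)"
      using MY by (intro mult_left_mono) auto
    finally show "norm (norm ((- w) ^ d * q ^ (d choose 2) * lowered_product I q a x d)) \<le>
        M * ((norm w * Y) ^ d * norm q ^ (d choose 2))"
      by (simp add: power_mult_distrib mult_ac)
  qed
qed

section \<open>Reduction of both series to the same single sum\<close>

lemma infsum_lhs_term:
  fixes a b z :: complex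
  assumes q0: "q \<noteq> 0" and q: "norm q < 1" and b: "b \<noteq> 0" and nr: "nonresonant {1..n} q x"
    and x1: "\<And>i t. i \<in> {1..n} \<Longrightarrow> b * x i * q ^ t \<noteq> 1"
    and nr': "nonresonant {1..n} q (\<lambda>i. b * x i)"
  defines "w \<equiv> z / a ^ (n - 1)"
  assumes w: "norm w < 1"
  shows "infsum (lhs_term n q a b z x) (multi_indices n) =
     (\<Sum>\<^sub>\<infinity>d. (- w) ^ d * q ^ (d choose 2) * lowered_product {1..n} q (\<lambda>_. a) (\<lambda>i. b * x i) d
        * (1 / qpoch q w (Suc d)))"
proof -
  let ?X = "\<lambda>i. b * x i" and ?a = "\<lambda>_::nat. a"
  define L where "L = lowered_product {1..n} q ?a ?X"
  define U where "U d = (- w) ^ d * q ^ (d choose 2) * L d" for d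
  obtain B where B: "B > 0" "\<And>d m. norm (qbinom q d m) \<le> B" using bounded_qbinom[OF q] by metis
  have lhs: "lhs_term n q a b z x summable_on multi_indices n"
    using lhs_term_summable[OF q0 q b nr w[unfolded w_def] x1 nr'] .
  have graded: "(\<Sum>k\<in>compositions {1..n} N. lhs_term n q a b z x k) =
     (\<Sum>d\<le>N. (\<lambda>(d, m). U d * (qbinom q d m * w ^ m)) (d, N - d))" for N
  proof -
    have "(\<Sum>k\<in>compositions {1..n} N. lhs_term n q a b z x k) =
      (\<Sum>k\<in>compositions {1..n} N. qpoch q q N * w ^ N * milne_term {1..n} q ?a ?X 1 0 k)"
    proof (rule sum.cong)
      fix k assume "k \<in> compositions {1..n} N"
      then have k: "mweight n k = N" by (simp add: compositions_def mweight_def)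
      show "lhs_term n q a b z x k = qpoch q q N * w ^ N * milne_term {1..n} q ?a ?X 1 0 k"
        unfolding lhs_term_eq[OF q0 b nr] k w_def[symmetric] ..
    qed simp
    also have "\<dots> = (\<Sum>d\<le>N. qpoch q q N * w ^ N * milne_coeff q (\<Prod>s\<in>{1..n}. a) 1 0 N d * L d)"
      unfolding L_def
      using milne_sum[OF _ q0 q nr' x1, where N = N and D = 1 and E = 0 and a = ?a]
      by (simp only: sum_distrib_left[symmetric] mult.assoc finite_atLeastAtMost)
    also have "\<dots> = (\<Sum>d\<le>N. (\<lambda>(d, m). U d * (qbinom q d m * w ^ m)) (d, N - d))"
    proof (rule sum.cong)
      fix d assume "d \<in> {..N}"
      then have "qpoch q q N * w ^ N * milne_coeff q (\<Prod>s\<in>{1..n}. a) 1 0 N d =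
          (- w) ^ d * q ^ (d choose 2) * (qbinom q d (N - d) * w ^ (N - d))"
        using lhs_coeff[of q d "N - d" w "\<Prod>s\<in>{1..n}. a"] by simp
      then show "qpoch q q N * w ^ N * milne_coeff q (\<Prod>s\<in>{1..n}. a) 1 0 N d * L d =
          (\<lambda>(d, m). U d * (qbinom q d m * w ^ m)) (d, N - d)"
        by (simp only: U_def prod.case mult_ac)
    qed simp
    finally show ?thesis .
  qed
  \<comment> \<open>The majorant decays like a Gaussian in \<open>d\<close> through \<open>U\<close>
    and geometrically in \<open>m\<close>.\<close>
  have "(\<lambda>(d, m). U d * (qbinom q d m * w ^ m)) summable_on UNIV"
  proof (rule summable_on_product_bound)
    show "summable (\<lambda>d. norm (U d))"
      unfolding U_def L_def using q x1 by (intro summable_leading_factor) auto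
    show "summable (\<lambda>m. B * norm w ^ m)" using w by simp
    show "norm ((\<lambda>(d, m). U d * (qbinom q d m * w ^ m)) (d, m)) \<le> norm (U d) * (B * norm w ^ m)" for d m
      unfolding prod.case norm_mult norm_power using B by (intro mult_left_mono mult_right_mono) auto
  qed (use B in auto)
  moreover have "(\<lambda>m. (\<lambda>(d, m). U d * (qbinom q d m * w ^ m)) (d, m)) sums (U d * (1 / qpoch q w (Suc d)))" for d
    unfolding prod.case by (intro sums_mult sums_qbinom q w)
  ultimately show ?thesis
    using infsum_multi_indices[OF lhs graded, of "\<lambda>d. U d * (1 / qpoch q w (Suc d))"] by (simp add: U_def L_def)
qed

lemma infsum_rhs_term:
  fixes a b z :: complex
  assumes q0: "q \<noteq> 0" and q: "norm q < 1" and b: "b \<noteq> 0" and nr: "nonresonant {1..n} q x"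
    and x1: "\<And>i t. i \<in> {1..n} \<Longrightarrow> b * x i * q ^ t \<noteq> 1"
    and nr': "nonresonant {1..n} q (\<lambda>i. b * x i)" and n: "n \<ge> 1" and a: "a ^ (n - 1) \<noteq> 0"
  defines "w \<equiv> z / a ^ (n - 1)"
  assumes w: "\<And>k. qpoch q w k \<noteq> 0"
  shows "infsum (rhs_term n q a b z x) (multi_indices n) =
     (\<Sum>\<^sub>\<infinity>d. (- w) ^ d * q ^ (d choose 2) * lowered_product {1..n} q (\<lambda>_. a) (\<lambda>i. b * x i) d
        * (1 / qpoch q w (Suc d)))"
proof -
  let ?X = "\<lambda>i. b * x i" and ?a = "\<lambda>_::nat. a"
  define A where "A = (\<Prod>s\<in>{1..n}. a)"
  \<comment> \<open>\<open>A = a ^ n\<close> because all \<open>a s\<close> are equal, which matches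
    the parameter \<open>A * w\<close> of \<open>rhs_coeff\<close>.\<close>
  have az: "a * z = A * w"
  proof -
    have "A = a * a ^ (n - 1)" using n by (simp add: A_def flip: power_Suc)
    then show ?thesis using a by (simp add: w_def)
  qed
  define L where "L = lowered_product {1..n} q ?a ?X"
  define U where "U d = (- w) ^ d * q ^ (d choose 2) * L d" for d
  define g where "g d m = U d / qpoch q w (Suc d) * unit_term q (A * w) d m" for d m
  obtain K where K: "K > 0"
    "\<And>d m. norm (unit_term q (A * w) d m) \<le> K * (norm (A * w) ^ m * norm q ^ (m choose 2))"
    using norm_unit_term_le[OF q, of "A * w"] by metis
  obtain B where B: "B > 0" "\<And>k. norm (inverse (qpoch q w k)) \<le> B"
    using bounded_inverse_qpoch[OF q w] by (auto simp: bounded_pos)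
  have rhs: "rhs_term n q a b z x summable_on multi_indices n"
    using rhs_term_summable[OF q0 q b nr w[unfolded w_def] x1 nr'] .
  have graded: "(\<Sum>k\<in>compositions {1..n} N. rhs_term n q a b z x k) =
     (\<Sum>d\<le>N. (\<lambda>(d, m). g d m) (d, N - d))" for N
  proof -
    define c where "c = (1 - A * w * q ^ (2 * N)) * qpoch q q N / qpoch q w (Suc N) *
      (- w) ^ N * q ^ (N choose 2)"
    have "(\<Sum>k\<in>compositions {1..n} N. rhs_term n q a b z x k) =
      (\<Sum>k\<in>compositions {1..n} N. c * milne_term {1..n} q ?a ?X (A * w * q ^ N) 1 k)"
    proof (rule sum.cong)
      fix k assume "k \<in> compositions {1..n} N"
      then have k: "mweight n k = N" by (simp add: compositions_def mweight_def)
      show "rhs_term n q a b z x k = c * milne_term {1..n} q ?a ?X (A * w * q ^ N) 1 k"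
        unfolding rhs_term_eq[OF q0 b nr] k az w_def[symmetric] c_def ..
    qed simp
    also have "\<dots> = (\<Sum>d\<le>N. c * milne_coeff q A (A * w * q ^ N) 1 N d * L d)"
      unfolding L_def A_def
      using milne_sum[OF _ q0 q nr' x1, where N = N and D = "(\<Prod>s\<in>{1..n}. a) * w * q ^ N" and E = 1 and a = ?a]
      by (simp only: sum_distrib_left[symmetric] mult.assoc finite_atLeastAtMost)
    also have "\<dots> = (\<Sum>d\<le>N. (\<lambda>(d, m). g d m) (d, N - d))"
    proof (rule sum.cong)
      fix d assume "d \<in> {..N}"
      then have "c * milne_coeff q A (A * w * q ^ N) 1 N d =
          (- w) ^ d * q ^ (d choose 2) / qpoch q w (Suc d) * unit_term q (A * w) d (N - d)"
        using rhs_coeff[of q w A d "N - d"] w by (simp add: c_def)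
      then show "c * milne_coeff q A (A * w * q ^ N) 1 N d * L d = (\<lambda>(d, m). g d m) (d, N - d)"
        by (simp add: U_def g_def mult_ac)
    qed simp
    finally show ?thesis .
  qed
  \<comment> \<open>Here the majorant is Gaussian in both indices; \<open>B\<close> bounds the
    reciprocals of \<open>qpoch q w (Suc d)\<close>.\<close>
  have "(\<lambda>(d, m). g d m) summable_on UNIV"
  proof (rule summable_on_product_bound)
    show "summable (\<lambda>d. norm (U d) * B)"
      unfolding U_def L_def using q x1 by (intro summable_mult2 summable_leading_factor) auto
    show "summable (\<lambda>m. K * (norm (A * w) ^ m * norm q ^ (m choose 2)))"
      using q by (intro summable_mult summable_power_gaussian) auto
    show "norm ((\<lambda>(d, m). g d m) (d, m)) \<le> norm (U d) * B * (K * (norm (A * w) ^ m * norm q ^ (m choose 2)))" for d m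
      unfolding prod.case g_def norm_mult divide_inverse[of "U d"] using K B
      by (intro mult_mono) (auto simp: norm_mult)
  qed (use B K in auto)
  moreover have "(\<lambda>m. (\<lambda>(d, m). g d m) (d, m)) sums (U d * (1 / qpoch q w (Suc d)))" for d
    using sums_mult[OF sums_unit_term[OF q, of "A * w" d], of "U d / qpoch q w (Suc d)"] by (simp add: g_def)
  ultimately show ?thesis
    using infsum_multi_indices[OF rhs graded, of "\<lambda>d. U d * (1 / qpoch q w (Suc d))"] by (simp add: U_def L_def)
qed

text \<open>Summability belongs to the conclusion because \<open>infsum\<close> has the default
  value 0 on families that are not summable. The condition on \<open>a ^ (n - 1)\<close> still
  admits \<open>a = 0\<close> when \<open>n = 1\<close>.\<close>

theorem theorem6p2:
  fixes q a b z :: complex and x :: "nat \<Rightarrow> complex" and n :: nat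
  assumes "0 < norm q" and "norm q < 1"
    and "n \<ge> 1"
    and "norm (z / a ^ (n - 1)) < 1"
    and "a ^ (n - 1) \<noteq> 0"
    and "\<And>i. i \<in> {1..n} \<Longrightarrow> x i \<noteq> 0"
    and "\<And>i. i \<in> {1..n} \<Longrightarrow> b * x i \<noteq> 0"
    and "\<And>r s. r \<in> {1..n} \<Longrightarrow> s \<in> {1..n} \<Longrightarrow> r < s \<Longrightarrow> 1 - x r / x s \<noteq> 0"
    and "\<And>r s k. r \<in> {1..n} \<Longrightarrow> s \<in> {1..n} \<Longrightarrow> qpoch q (q * x r / x s) k \<noteq> 0"
    and "\<And>i k. i \<in> {1..n} \<Longrightarrow> qpoch q (b * x i) k \<noteq> 0"
    and "\<And>k. qpoch q (z / a ^ (n - 1)) (k + 1) \<noteq> 0"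
  shows "lhs_term n q a b z x summable_on multi_indices n \<and>
         rhs_term n q a b z x summable_on multi_indices n \<and>
         (\<Sum>\<^sub>\<infinity>j\<in>multi_indices n. lhs_term n q a b z x j) =
         (\<Sum>\<^sub>\<infinity>k\<in>multi_indices n. rhs_term n q a b z x k)"
proof -
  have q0: "q \<noteq> 0" and b: "b \<noteq> 0"
    using assms(1,3) assms(7)[of 1] by auto
  have nz: "x r * q ^ Suc t \<noteq> x s" if "r \<in> {1..n}" "s \<in> {1..n}" for r s t
  proof -
    have "1 - q * x r / x s * q ^ t \<noteq> 0"
      using assms(9)[OF that, of "Suc t"] by (auto simp: qpoch_def)
    then show ?thesis using assms(6)[OF that(2)] by (auto simp: field_simps)
  qed
  have inj: "inj_on x {1..n}"
  proof (rule linorder_inj_onI)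
    fix r s assume "r < s" "r \<in> {1..n}" "s \<in> {1..n}"
    then show "x r \<noteq> x s" using assms(8)[of r s] assms(6)[of s] by auto
  qed auto
  have nr: "nonresonant {1..n} q x"
    using assms(6) inj nz unfolding nonresonant_def by blast
  then have nr': "nonresonant {1..n} q (\<lambda>i. b * x i)"
    by (rule nonresonant_scale[OF b])
  have x1: "b * x i * q ^ t \<noteq> 1" if "i \<in> {1..n}" for i t
    using assms(10)[OF that, of "Suc t"] by (auto simp: qpoch_def)
  \<comment> \<open>The hypothesis covers lengths from 1 on; the empty product is 1.\<close>
  have w: "qpoch q (z / a ^ (n - 1)) k \<noteq> 0" for k
    using assms(11)[of "k - 1"] by (cases k) (auto simp: qpoch_def)
  show ?thesis
    using lhs_term_summable[OF q0 assms(2) b nr assms(4) x1 nr']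
      rhs_term_summable[OF q0 assms(2) b nr w x1 nr']
      infsum_lhs_term[OF q0 assms(2) b nr x1 nr' assms(4)]
      infsum_rhs_term[OF q0 assms(2) b nr x1 nr' assms(3,5) w]
    by simp
qed

end
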